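(* Let $W$ be a Weyl group, $\mathbf I=\{w\in W;w^2=1\}$, and let $M_1$ be the $W$-module over $\mathbb Q$ with basis $(a_w)_{w\in\mathbf I}$ described in the context. For $w\in\mathbf I$ let $Z(w)$ be the centralizer of $w$ in $W$ and let $\epsilon_w:Z(w)\to\{1,-1\}$ be the homomorphism $x\mapsto\epsilon_{x,w}$ described in the context. Then, as $W$-modules, $$M_1\cong\bigoplus_w \mathrm{Ind}_{Z(w)}^W(\epsilon_w),$$ where $w$ runs over a set of representatives for the conjugacy classes of $W$ contained in $\mathbf I$.
   Context: $W$ is a (finite) Weyl group with standard generating set $S$ and Bruhat order $\le$. $M_1$ is the $\mathbb Q$-vector space with basis $(a_w)_{w\in\mathbf I}$ with the $W$-module structure such that for $s\in S$, $w\in\mathbf I$: $s(a_w)=a_w+2a_{sw}$ if $sw=ws>w$; $s(a_w)=-a_w$ if $sw=ws<w$; $s(a_w)=a_{sws}$ if $sw\neq ws$. For $w\in\mathbf I$ let $h(w)$ be the dimension of the $(-1)$-eigenspace of $w$ in the reflection representation of $W$ over $\mathbb Q$. For $i\in\mathbb N$ the subspace $M_1^{\ge i}$ of $M_1$ spanned by $\{a_w;h(w)\ge i\}$ is a $W$-submodule; let $gr(M_1)=\bigoplus_{i\in\mathbb N}M_1^{\ge i}/M_1^{\ge i+1}$, a $W$-module, and let $\tilde a_w$ be the image of $a_w$ in $M_1^{\ge h(w)}/M_1^{\ge h(w)+1}$. The $\tilde a_w$ ($w\in\mathbf I$) form a basis of $gr(M_1)$, and for $s\in S$ one has $s(\tilde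 a_w)=-\tilde a_{sws}$ if $sw=ws<w$ and $s(\tilde a_w)=\tilde a_{sws}$ for all other $w\in\mathbf I$. Hence for $x\in W$, $w\in\mathbf I$ one has $x(\tilde a_w)=\epsilon_{x,w}\tilde a_{xwx^{-1}}$ with $\epsilon_{x,w}\in\{1,-1\}$ and $\epsilon_{xy,w}=\epsilon_{x,ywy^{-1}}\epsilon_{y,w}$ for $x,y\in W$; this defines $\epsilon_{x,w}$, and $x\mapsto\epsilon_{x,w}$ restricted to $Z(w)$ is the homomorphism $\epsilon_w$. *)

theory Defs
  imports Complex_Main "HOL-Algebra.Generated_Groups" "HOL-Library.Function_Algebras"
begin

section \<open>Groups, length and Bruhat order\<close>

definition GL :: "(rat \<Rightarrow> 'v::ab_group_add \<Rightarrow> 'v) \<Rightarrow> ('v \<Rightarrow> 'v) monoid" where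
  "GL scale = \<lparr>carrier = {f. Vector_Spaces.linear scale scale f \<and> bij f}, mult = (\<circ>), one = id\<rparr>"

definition involutions :: "('g, 'z) monoid_scheme \<Rightarrow> 'g set" where
  "involutions G = {w \<in> carrier G. w \<otimes>\<^bsub>G\<^esub> w = \<one>\<^bsub>G\<^esub>}"

definition conjugate :: "('g, 'z) monoid_scheme \<Rightarrow> 'g \<Rightarrow> 'g \<Rightarrow> 'g" where
  "conjugate G x w = x \<otimes>\<^bsub>G\<^esub> w \<otimes>\<^bsub>G\<^esub> inv\<^bsub>G\<^esub> x"

definition centralizer :: "('g, 'z) monoid_scheme \<Rightarrow> 'g \<Rightarrow> 'g set" where
  "centralizer G w = {x \<in> carrier G. x \<otimes>\<^bsub>G\<^esub> w = w \<otimes>\<^bsub>G\<^esub> x}"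

definition conj_class :: "('g, 'z) monoid_scheme \<Rightarrow> 'g \<Rightarrow> 'g set" where
  "conj_class G w = (\<lambda>x. conjugate G x w) ` carrier G"

text \<open>A set of representatives for the conjugacy classes contained in \<open>I\<close>.\<close>

definition class_representatives :: "('g, 'z) monoid_scheme \<Rightarrow> 'g set \<Rightarrow> 'g set \<Rightarrow> bool" where
  "class_representatives G I R \<longleftrightarrow>
     R \<subseteq> I \<and> (\<forall>w\<in>carrier G. conj_class G w \<subseteq> I \<longrightarrow> (\<exists>!r. r \<in> R \<inter> conj_class G w))"

definition word_length :: "('g, 'z) monoid_scheme \<Rightarrow> 'g set \<Rightarrow> 'g \<Rightarrow> nat" where
  "word_length G S w =
     (LEAST n. \<exists>xs. length xs = n \<and> set xs \<subseteq> S \<and> foldr (\<otimes>\<^bsub>G\<^esub>) xs \<one>\<^bsub>G\<^esub> = w)"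

text \<open>The strict Bruhat order: the transitive closure of \<open>u \<rightarrow> ut\<close> with \<open>t\<close> a conjugate of an
  element of \<open>S\<close> and \<open>ut\<close> longer than \<open>u\<close>.\<close>

definition bruhat_less :: "('g, 'z) monoid_scheme \<Rightarrow> 'g set \<Rightarrow> 'g \<Rightarrow> 'g \<Rightarrow> bool" where
  "bruhat_less G S u w \<longleftrightarrow>
     (u, w) \<in> {(u, u \<otimes>\<^bsub>G\<^esub> conjugate G x s) | u x s.
                 u \<in> carrier G \<and> x \<in> carrier G \<and> s \<in> S \<and>
                 word_length G S u < word_length G S (u \<otimes>\<^bsub>G\<^esub> conjugate G x s)}\<^sup>+"

section \<open>Weyl groups\<close>

text \<open>Reduced crystallographic root systems, in the form without an inner product: the space is
  rational and \<open>coroot \<alpha>\<close> is the linear form \<open>\<langle>_, \<alpha>\<^sup>\<or>\<rangle>\<close>. Since \<open>\<Phi>\<close> is finite and spans, the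
  space is finite-dimensional.\<close>

locale root_system = vector_space scale
  for scale :: "rat \<Rightarrow> 'v::ab_group_add \<Rightarrow> 'v" +
  fixes \<Phi> :: "'v set" and coroot :: "'v \<Rightarrow> 'v \<Rightarrow> rat"
  assumes finite_roots: "finite \<Phi>"
    and span_roots: "span \<Phi> = UNIV"
    and zero_not_root: "0 \<notin> \<Phi>"
    and linear_coroot: "\<alpha> \<in> \<Phi> \<Longrightarrow> Vector_Spaces.linear scale (*) (coroot \<alpha>)"
    and coroot_self: "\<alpha> \<in> \<Phi> \<Longrightarrow> coroot \<alpha> \<alpha> = 2"
    and reflection_root: "\<alpha> \<in> \<Phi> \<Longrightarrow> \<beta> \<in> \<Phi> \<Longrightarrow> \<beta> - scale (coroot \<alpha> \<beta>) \<alpha> \<in> \<Phi>"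
    and crystallographic: "\<alpha> \<in> \<Phi> \<Longrightarrow> \<beta> \<in> \<Phi> \<Longrightarrow> coroot \<alpha> \<beta> \<in> \<int>"
    and reduced: "\<alpha> \<in> \<Phi> \<Longrightarrow> scale c \<alpha> \<in> \<Phi> \<Longrightarrow> c = 1 \<or> c = - 1"

definition root_base :: "(rat \<Rightarrow> 'v::ab_group_add \<Rightarrow> 'v) \<Rightarrow> 'v set \<Rightarrow> 'v set \<Rightarrow> bool" where
  "root_base scale \<Phi> \<Delta> \<longleftrightarrow>
     \<Delta> \<subseteq> \<Phi> \<and> \<not> module.dependent scale \<Delta> \<and>
     (\<forall>\<beta>\<in>\<Phi>. \<exists>c :: 'v \<Rightarrow> nat. \<beta> = (\<Sum>\<alpha>\<in>\<Delta>. scale (of_nat (c \<alpha>)) \<alpha>) \<or>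
                              \<beta> = - (\<Sum>\<alpha>\<in>\<Delta>. scale (of_nat (c \<alpha>)) \<alpha>))"

definition reflection ::
  "(rat \<Rightarrow> 'v::ab_group_add \<Rightarrow> 'v) \<Rightarrow> ('v \<Rightarrow> 'v \<Rightarrow> rat) \<Rightarrow> 'v \<Rightarrow> 'v \<Rightarrow> 'v" where
  "reflection scale coroot \<alpha> v = v - scale (coroot \<alpha> v) \<alpha>"

text \<open>The Weyl group is a group of linear maps, so its reflection representation over the
  rationals is the tautological one.\<close>

definition weyl_group ::
  "(rat \<Rightarrow> 'v::ab_group_add \<Rightarrow> 'v) \<Rightarrow> 'v set \<Rightarrow> ('v \<Rightarrow> 'v \<Rightarrow> rat) \<Rightarrow> ('v \<Rightarrow> 'v) monoid" where
  "weyl_group scale \<Phi> coroot =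
     (GL scale)\<lparr>carrier := generate (GL scale) (reflection scale coroot ` \<Phi>)\<rparr>"

definition neg_eigendim :: "(rat \<Rightarrow> 'v::ab_group_add \<Rightarrow> 'v) \<Rightarrow> ('v \<Rightarrow> 'v) \<Rightarrow> nat" where
  "neg_eigendim scale w = vector_space.dim scale {v. w v = - v}"

section \<open>Representations\<close>

text \<open>Isomorphism of the modules \<open>(V\<^sub>1, \<rho>\<^sub>1)\<close> and \<open>(V\<^sub>2, \<rho>\<^sub>2)\<close>, where \<open>V\<^sub>1\<close>, \<open>V\<^sub>2\<close> are subspaces
  of the ambient types.\<close>

definition rep_isomorphic ::
  "('g, 'z) monoid_scheme \<Rightarrow>
   (rat \<Rightarrow> 'm::ab_group_add \<Rightarrow> 'm) \<Rightarrow> 'm set \<Rightarrow> ('g \<Rightarrow> 'm \<Rightarrow> 'm) \<Rightarrow>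
   (rat \<Rightarrow> 'n::ab_group_add \<Rightarrow> 'n) \<Rightarrow> 'n set \<Rightarrow> ('g \<Rightarrow> 'n \<Rightarrow> 'n) \<Rightarrow> bool" where
  "rep_isomorphic G scale\<^sub>1 V\<^sub>1 \<rho>\<^sub>1 scale\<^sub>2 V\<^sub>2 \<rho>\<^sub>2 \<longleftrightarrow>
     (\<exists>T. bij_betw T V\<^sub>1 V\<^sub>2 \<and>
          (\<forall>u\<in>V\<^sub>1. \<forall>v\<in>V\<^sub>1. T (u + v) = T u + T v) \<and>
          (\<forall>c. \<forall>v\<in>V\<^sub>1. T (scale\<^sub>1 c v) = scale\<^sub>2 c (T v)) \<and>
          (\<forall>x\<in>carrier G. \<forall>v\<in>V\<^sub>1. T (\<rho>\<^sub>1 x v) = \<rho>\<^sub>2 x (T v)))"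

text \<open>The representation of \<open>G\<close> induced from a one-dimensional character \<open>\<chi>\<close> of the subgroup
  \<open>H\<close>, realized on functions with \<open>f (gh) = \<chi> (h)\<^sup>-\<^sup>1 f (g)\<close>, with \<open>G\<close> acting by left
  translation; functions are set to 0 off the carrier. For infinite \<open>G\<close> one would
  add a condition on supports.\<close>

definition ind_space :: "('g, 'z) monoid_scheme \<Rightarrow> 'g set \<Rightarrow> ('g \<Rightarrow> rat) \<Rightarrow> ('g \<Rightarrow> rat) set" where
  "ind_space G H \<chi> =
     {f. (\<forall>g. g \<notin> carrier G \<longrightarrow> f g = 0) \<and>
         (\<forall>g\<in>carrier G. \<forall>h\<in>H. f (g \<otimes>\<^bsub>G\<^esub> h) = inverse (\<chi> h) * f g)}"

definition ind_action :: "('g, 'z) monoid_scheme \<Rightarrow> 'g \<Rightarrow> ('g \<Rightarrow> rat) \<Rightarrow> 'g \<Rightarrow> rat" where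
  "ind_action G x f g = (if g \<in> carrier G then f (inv\<^bsub>G\<^esub> x \<otimes>\<^bsub>G\<^esub> g) else 0)"

text \<open>External direct sum of spaces of functions, indexed by \<open>R\<close>.\<close>

definition direct_sum_space :: "'i set \<Rightarrow> ('i \<Rightarrow> ('g \<Rightarrow> rat) set) \<Rightarrow> ('i \<Rightarrow> 'g \<Rightarrow> rat) set" where
  "direct_sum_space R V =
     {F. (\<forall>r\<in>R. F r \<in> V r) \<and> (\<forall>r. r \<notin> R \<longrightarrow> F r = 0) \<and> finite {r. F r \<noteq> 0}}"

definition direct_sum_action ::
  "'i set \<Rightarrow> ('i \<Rightarrow> 'x \<Rightarrow> ('g \<Rightarrow> rat) \<Rightarrow> 'g \<Rightarrow> rat) \<Rightarrow> 'x \<Rightarrow> ('i \<Rightarrow> 'g \<Rightarrow> rat) \<Rightarrow> 'i \<Rightarrow> 'g \<Rightarrow> rat" where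
  "direct_sum_action R \<sigma> x F r = (if r \<in> R then \<sigma> r x (F r) else 0)"

definition direct_sum_scale :: "rat \<Rightarrow> ('i \<Rightarrow> 'g \<Rightarrow> rat) \<Rightarrow> 'i \<Rightarrow> 'g \<Rightarrow> rat" where
  "direct_sum_scale c F r g = c * F r g"

section \<open>The module of involutions\<close>

locale involution_module = vector_space scale
  for scale :: "rat \<Rightarrow> 'm::ab_group_add \<Rightarrow> 'm" +
  fixes W :: "('g, 'z) monoid_scheme" and S :: "'g set"
    and a :: "'g \<Rightarrow> 'm" and \<rho> :: "'g \<Rightarrow> 'm \<Rightarrow> 'm"
  assumes inj_a: "inj_on a (involutions W)"
    and independent_a: "independent (a ` involutions W)"
    and span_a: "span (a ` involutions W) = UNIV"
    and representation_hom: "\<rho> \<in> hom W (GL scale)"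
    and action_up: "\<lbrakk>s \<in> S; w \<in> involutions W; s \<otimes>\<^bsub>W\<^esub> w = w \<otimes>\<^bsub>W\<^esub> s; bruhat_less W S w (s \<otimes>\<^bsub>W\<^esub> w)\<rbrakk>
           \<Longrightarrow> \<rho> s (a w) = a w + scale 2 (a (s \<otimes>\<^bsub>W\<^esub> w))"
    and action_down: "\<lbrakk>s \<in> S; w \<in> involutions W; s \<otimes>\<^bsub>W\<^esub> w = w \<otimes>\<^bsub>W\<^esub> s; bruhat_less W S (s \<otimes>\<^bsub>W\<^esub> w) w\<rbrakk>
           \<Longrightarrow> \<rho> s (a w) = - a w"
    and action_conj: "\<lbrakk>s \<in> S; w \<in> involutions W; s \<otimes>\<^bsub>W\<^esub> w \<noteq> w \<otimes>\<^bsub>W\<^esub> s\<rbrakk>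
           \<Longrightarrow> \<rho> s (a w) = a (s \<otimes>\<^bsub>W\<^esub> w \<otimes>\<^bsub>W\<^esub> s)"

text \<open>The filtration attached to a height function \<open>h\<close>, and the basis element of the associated
  graded module given by \<open>w\<close>: elements of the quotient \<open>M\<^sup>\<ge>\<^sup>i / M\<^sup>\<ge>\<^sup>i\<^sup>+\<^sup>1\<close> are cosets.\<close>

definition filtration ::
  "(rat \<Rightarrow> 'm::ab_group_add \<Rightarrow> 'm) \<Rightarrow> ('g, 'z) monoid_scheme \<Rightarrow> ('g \<Rightarrow> nat) \<Rightarrow> ('g \<Rightarrow> 'm) \<Rightarrow> nat \<Rightarrow> 'm set"
  where
  "filtration scale W h a i = module.span scale (a ` {w \<in> involutions W. i \<le> h w})"

definition graded_basis ::
  "(rat \<Rightarrow> 'm::ab_group_add \<Rightarrow> 'm) \<Rightarrow> ('g, 'z) monoid_scheme \<Rightarrow> ('g \<Rightarrow> nat) \<Rightarrow> ('g \<Rightarrow> 'm) \<Rightarrow> 'g \<Rightarrow> 'm set"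
  where
  "graded_basis scale W h a w = (\<lambda>u. a w + u) ` filtration scale W h a (h w + 1)"

text \<open>The sign by which \<open>x\<close> carries the graded basis element of \<open>w\<close> to that of \<open>xwx\<^sup>-\<^sup>1\<close>; group
  elements and scalars act on cosets elementwise.\<close>

definition epsilon ::
  "(rat \<Rightarrow> 'm::ab_group_add \<Rightarrow> 'm) \<Rightarrow> ('g, 'z) monoid_scheme \<Rightarrow> ('g \<Rightarrow> nat) \<Rightarrow> ('g \<Rightarrow> 'm) \<Rightarrow>
   ('g \<Rightarrow> 'm \<Rightarrow> 'm) \<Rightarrow> 'g \<Rightarrow> 'g \<Rightarrow> rat"
  where
  "epsilon scale W h a \<rho> x w =
     (THE e. e \<in> {1, - 1} \<and>
             \<rho> x ` graded_basis scale W h a w = scale e ` graded_basis scale W h a (conjugate W x w))"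

end

theory Submission
  imports Defs
begin

text \<open>Send a family \<open>F\<close> in the direct sum of the induced modules to
  \<open>\<Sum>\<^sub>r \<Sum>\<^sub>g F r g \<cdot> g(a\<^sub>r)\<close>. This map is equivariant. Modulo the filtration by \<open>h\<close>, each
  \<open>g(a\<^sub>r)\<close> is \<open>\<epsilon>\<^sub>g\<^sub>,\<^sub>r\<close> times the basis element of \<open>grg\<^sup>-\<^sup>1\<close>, and the factor \<open>F r g \<epsilon>\<^sub>g\<^sub>,\<^sub>r\<close> depends only
  on \<open>grg\<^sup>-\<^sup>1\<close>, so that the coefficient of \<open>a\<^sub>w\<close> in the image is a nonzero integer multiple of it
  whenever \<open>F\<close> vanishes in lower heights. Looking at the lowest height gives injectivity; descending
  induction on the height gives surjectivity.

  That the filtration is stable rests on one fact on Weyl groups: if \<open>s = s\<^sub>\<alpha>\<close> is simple and commutes with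
  \<open>w\<close>, then \<open>w \<alpha> = \<plusminus>\<alpha>\<close>. By the exchange condition the sign decides whether \<open>sw > w\<close>, and for the
  sign \<open>+\<close> the \<open>(-1)\<close>-eigenspace of \<open>sw\<close> contains \<open>\<alpha>\<close> in addition to that of \<open>w\<close>.\<close>

section \<open>Weyl groups\<close>

lemma GL_simps [simp]:
  "carrier (GL scale) = {f. Vector_Spaces.linear scale scale f \<and> bij f}"
  "mult (GL scale) = (\<circ>)" "one (GL scale) = id"
  by (simp_all add: GL_def)

lemma weyl_group_simps [simp]:
  "carrier (weyl_group scale \<Phi> coroot) = generate (GL scale) (reflection scale coroot ` \<Phi>)"
  "mult (weyl_group scale \<Phi> coroot) = (\<circ>)" "one (weyl_group scale \<Phi> coroot) = id"
  by (simp_all add: weyl_group_def)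

lemma linear_inv_bij:
  fixes f :: "'v::ab_group_add \<Rightarrow> 'v"
  assumes "Vector_Spaces.linear scale scale f" "bij f"
  shows "Vector_Spaces.linear scale scale (Hilbert_Choice.inv f)"
proof -
  interpret f: Vector_Spaces.linear scale scale f by fact
  note inv = surj_f_inv_f[OF bij_is_surj[OF assms(2)]] inv_f_f[OF bij_is_inj[OF assms(2)]]
  show ?thesis
    unfolding Vector_Spaces.linear_iff
  proof (intro conjI allI f.vs1.vector_space_axioms)
    show "Hilbert_Choice.inv f (u + v) = Hilbert_Choice.inv f u + Hilbert_Choice.inv f v" for u v
      by (metis inv f.add)
    show "Hilbert_Choice.inv f (scale c v) = scale c (Hilbert_Choice.inv f v)" for c v
      by (metis inv f.scale)
  qed
qed

lemma group_GL:
  assumes "vector_space scale"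
  shows "group (GL scale)"
proof (rule groupI)
  interpret vector_space scale by fact
  show "\<one>\<^bsub>GL scale\<^esub> \<in> carrier (GL scale)" by (simp add: linear_id[unfolded id_def[symmetric]])
  fix f assume f: "f \<in> carrier (GL scale)"
  show "\<exists>g\<in>carrier (GL scale). g \<otimes>\<^bsub>GL scale\<^esub> f = \<one>\<^bsub>GL scale\<^esub>"
    using f linear_inv_bij[of scale f] bij_imp_bij_inv[of f]
    by (intro bexI[of _ "Hilbert_Choice.inv f"]) (auto simp: bij_is_inj)
qed (auto simp: comp_assoc bij_comp intro: Vector_Spaces.linear_compose)

context root_system
begin

abbreviation refl :: "'v \<Rightarrow> 'v \<Rightarrow> 'v" where
  "refl \<equiv> reflection scale coroot"

abbreviation W :: "('v \<Rightarrow> 'v) monoid" where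
  "W \<equiv> weyl_group scale \<Phi> coroot"

section \<open>Reflections and their action on the roots\<close>

lemma coroot_simps:
  assumes "\<alpha> \<in> \<Phi>"
  shows "coroot \<alpha> (u + v) = coroot \<alpha> u + coroot \<alpha> v"
    "coroot \<alpha> (u - v) = coroot \<alpha> u - coroot \<alpha> v"
    "coroot \<alpha> (- v) = - coroot \<alpha> v"
    "coroot \<alpha> (scale c v) = c * coroot \<alpha> v"
    "coroot \<alpha> \<alpha> = 2"
proof -
  interpret l: Vector_Spaces.linear scale "(*)" "coroot \<alpha>" by (rule linear_coroot[OF assms])
  show "coroot \<alpha> (u + v) = coroot \<alpha> u + coroot \<alpha> v"
    "coroot \<alpha> (u - v) = coroot \<alpha> u - coroot \<alpha> v"
    "coroot \<alpha> (- v) = - coroot \<alpha> v"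
    "coroot \<alpha> (scale c v) = c * coroot \<alpha> v"
    by (rule l.add l.diff l.neg l.scale)+
qed (rule coroot_self[OF assms])

lemma linear_refl: "\<alpha> \<in> \<Phi> \<Longrightarrow> Vector_Spaces.linear scale scale (refl \<alpha>)"
  unfolding Vector_Spaces.linear_iff
  by (auto simp: vector_space_axioms reflection_def coroot_simps algebra_simps)

lemma refl_refl [simp]: "\<alpha> \<in> \<Phi> \<Longrightarrow> refl \<alpha> (refl \<alpha> v) = v"
  by (simp add: reflection_def coroot_simps algebra_simps)

lemma refl_comp_refl [simp]: "\<alpha> \<in> \<Phi> \<Longrightarrow> refl \<alpha> \<circ> refl \<alpha> = id"
  by (simp add: fun_eq_iff)

lemma scale_two: "scale 2 v = v + v"
  using scale_left_distrib[of 1 1 v] by simp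

lemma refl_self [simp]: "\<alpha> \<in> \<Phi> \<Longrightarrow> refl \<alpha> \<alpha> = - \<alpha>"
  by (simp add: reflection_def coroot_simps scale_two)

lemma refl_root: "\<alpha> \<in> \<Phi> \<Longrightarrow> \<beta> \<in> \<Phi> \<Longrightarrow> refl \<alpha> \<beta> \<in> \<Phi>"
  using reflection_root by (simp add: reflection_def)

lemma uminus_root: "\<alpha> \<in> \<Phi> \<Longrightarrow> - \<alpha> \<in> \<Phi>"
  using refl_root[of \<alpha> \<alpha>] by simp

lemma bij_refl: "\<alpha> \<in> \<Phi> \<Longrightarrow> bij (refl \<alpha>)"
  by (rule o_bij[of "refl \<alpha>"]) simp_all

lemma refl_in_GL: "refl ` \<Phi> \<subseteq> carrier (GL scale)"
  using linear_refl bij_refl by auto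

lemma group_W: "group W"
  unfolding weyl_group_def
  by (intro group.subgroup_imp_group[OF group_GL[OF vector_space_axioms]] group.generate_is_subgroup[OF group_GL[OF vector_space_axioms]] refl_in_GL)

lemma refl_in_W: "\<alpha> \<in> \<Phi> \<Longrightarrow> refl \<alpha> \<in> carrier W"
  by (simp add: generate.incl)

lemma W_linear: "w \<in> carrier W \<Longrightarrow> Vector_Spaces.linear scale scale w"
  and W_bij: "w \<in> carrier W \<Longrightarrow> bij w"
  using group.generate_incl[OF group_GL[OF vector_space_axioms] refl_in_GL] by auto

lemma W_comp: "x \<in> carrier W \<Longrightarrow> y \<in> carrier W \<Longrightarrow> x \<circ> y \<in> carrier W"
  using group.is_monoid[OF group_W, THEN monoid.m_closed, of x y] by simp

lemma W_inv:
  assumes "w \<in> carrier W"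
  shows "inv\<^bsub>W\<^esub> w \<in> carrier W" "w \<circ> inv\<^bsub>W\<^esub> w = id" "inv\<^bsub>W\<^esub> w \<circ> w = id"
    "w ((inv\<^bsub>W\<^esub> w) v) = v" "(inv\<^bsub>W\<^esub> w) (w v) = v"
proof -
  show "inv\<^bsub>W\<^esub> w \<in> carrier W" by (rule group.inv_closed[OF group_W assms])
  show *: "w \<circ> inv\<^bsub>W\<^esub> w = id" "inv\<^bsub>W\<^esub> w \<circ> w = id"
    using group.r_inv[OF group_W assms] group.l_inv[OF group_W assms] by (simp_all only: weyl_group_simps)
  show "w ((inv\<^bsub>W\<^esub> w) v) = v" "(inv\<^bsub>W\<^esub> w) (w v) = v"
    using * by (metis comp_apply id_apply)+
qed

lemma W_root:
  assumes "w \<in> carrier W" "\<beta> \<in> \<Phi>"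
  shows "w \<beta> \<in> \<Phi>"
proof -
  have "w \<in> generate (GL scale) (refl ` \<Phi>)" using assms by simp
  then show ?thesis using assms(2)
  proof (induction arbitrary: \<beta> rule: generate.induct)
    case (inv h)
    then obtain \<alpha> where \<alpha>: "\<alpha> \<in> \<Phi>" "h = refl \<alpha>" by auto
    have "inv\<^bsub>GL scale\<^esub> h = h"
      using \<alpha> refl_in_GL by (intro group.inv_equality[OF group_GL[OF vector_space_axioms]]) auto
    then show ?case using \<alpha> inv refl_root by simp
  qed (auto intro: refl_root)
qed

text \<open>As the roots span the space, an element is determined by its restriction to
  \<open>\<Phi>\<close>, and this is one of the finitely many maps from \<open>\<Phi>\<close> to
  itself.\<close>

lemma finite_W: "finite (carrier W)"
proof (rule finite_imageD)
  show "finite ((\<lambda>w. restrict w \<Phi>) ` carrier W)"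
    by (rule finite_subset[OF _ finite_PiE[OF finite_roots, of "\<lambda>_. \<Phi>"]])
       (use W_root finite_roots in auto)
  show "inj_on (\<lambda>w. restrict w \<Phi>) (carrier W)"
  proof (rule inj_onI)
    fix x y assume *: "x \<in> carrier W" "y \<in> carrier W" "restrict x \<Phi> = restrict y \<Phi>"
    interpret vector_space_pair scale scale ..
    have on_roots: "x v = y v" if "v \<in> \<Phi>" for v
      using fun_cong[OF *(3), of v] that by simp
    have "x v = y v" for v
      by (rule linear_eq_on[OF W_linear[OF *(1)] W_linear[OF *(2)], of _ \<Phi>])
         (use span_roots on_roots in auto)
    then show "x = y" by auto
  qed
qed

text \<open>Two reflections with the same root \<open>\<alpha>\<close> differ by the unipotent map
  \<open>x \<mapsto> x + (f x - coroot \<alpha> x) \<alpha>\<close>, which preserves the finite set of roots and so has finite order.\<close>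

lemma coroot_unique:
  assumes \<alpha>: "\<alpha> \<in> \<Phi>" and f: "Vector_Spaces.linear scale (*) f" and f2: "f \<alpha> = 2"
    and f_root: "\<And>\<beta>. \<beta> \<in> \<Phi> \<Longrightarrow> \<beta> - scale (f \<beta>) \<alpha> \<in> \<Phi>"
  shows "f = coroot \<alpha>"
proof -
  interpret f: Vector_Spaces.linear scale "(*)" f by (rule f)
  define g where "g x = f x - coroot \<alpha> x" for x
  have g0: "g \<alpha> = 0" by (simp add: g_def f2 coroot_simps \<alpha>)
  have g_add: "g (x + scale c \<alpha>) = g x" for x c
    using g0 by (simp add: g_def f.add f.scale coroot_simps \<alpha> algebra_simps)
  have step: "\<beta> + scale (g \<beta>) \<alpha> \<in> \<Phi>" if "\<beta> \<in> \<Phi>" for \<beta>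
  proof -
    have "refl \<alpha> (\<beta> - scale (f \<beta>) \<alpha>) = \<beta> + scale (g \<beta>) \<alpha>"
      by (simp add: reflection_def coroot_simps \<alpha> g_def algebra_simps scale_two mult_2
            flip: scale_scale)
    then show ?thesis using refl_root[OF \<alpha> f_root[OF that]] by simp
  qed
  \<comment> \<open>\<open>g\<close> does not change when a multiple of \<alpha> is added, so every
    further application of the unipotent map adds the same multiple of \<alpha>.\<close>
  have iter: "\<beta> + scale (of_nat n * g \<beta>) \<alpha> \<in> \<Phi>" if "\<beta> \<in> \<Phi>" for \<beta> n
  proof (induction n)
    case (Suc n)
    from step[OF this] show ?case by (simp add: g_add algebra_simps)
  qed (simp add: that)
  have "g \<beta> = 0" if \<beta>: "\<beta> \<in> \<Phi>" for \<beta>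
  proof (rule ccontr)
    assume nz: "g \<beta> \<noteq> 0"
    have "inj (\<lambda>n::nat. \<beta> + scale (of_nat n * g \<beta>) \<alpha>)"
      using nz zero_not_root \<alpha> by (auto intro!: injI)
    moreover have "finite (range (\<lambda>n::nat. \<beta> + scale (of_nat n * g \<beta>) \<alpha>))"
      using iter[OF \<beta>] finite_roots by (auto intro: finite_subset)
    ultimately show False using finite_imageD infinite_UNIV_nat by blast
  qed
  moreover interpret vector_space_pair scale "(*) :: rat \<Rightarrow> rat \<Rightarrow> rat" ..
  have "f x = coroot \<alpha> x" for x
    by (rule linear_eq_on[OF f linear_coroot[OF \<alpha>]])
       (use span_roots calculation in \<open>auto simp: g_def\<close>)
  then show ?thesis by auto
qed

text \<open>The conjugate of \<open>refl \<alpha>\<close> by \<open>w\<close> negates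
  \<open>w \<alpha>\<close> and preserves the roots, so \<open>coroot_unique\<close> identifies its
  linear form with \<open>coroot (w \<alpha>)\<close>. This takes the place of the argument that
  \<open>w\<close> is an isometry.\<close>

lemma conj_refl:
  assumes w: "w \<in> carrier W" and \<alpha>: "\<alpha> \<in> \<Phi>"
  shows "w \<circ> refl \<alpha> = refl (w \<alpha>) \<circ> w"
proof -
  let ?v = "inv\<^bsub>W\<^esub> w"
  interpret w: Vector_Spaces.linear scale scale w by (rule W_linear[OF w])
  note v = W_inv[OF w]
  have "coroot \<alpha> \<circ> ?v = coroot (w \<alpha>)"
  proof (rule coroot_unique[OF W_root[OF w \<alpha>]])
    show "Vector_Spaces.linear scale (*) (coroot \<alpha> \<circ> ?v)"
      by (rule Vector_Spaces.linear_compose[OF W_linear[OF v(1)] linear_coroot[OF \<alpha>]])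
    show "(coroot \<alpha> \<circ> ?v) (w \<alpha>) = 2" by (simp add: v \<alpha> coroot_simps del: weyl_group_simps)
    fix \<beta> assume "\<beta> \<in> \<Phi>"
    then have "w (refl \<alpha> (?v \<beta>)) \<in> \<Phi>" by (rule W_root[OF w refl_root[OF \<alpha> W_root[OF v(1)]]])
    then show "\<beta> - scale ((coroot \<alpha> \<circ> ?v) \<beta>) (w \<alpha>) \<in> \<Phi>"
      by (simp add: reflection_def w.diff w.scale v(4))
  qed
  then have "coroot (w \<alpha>) (w x) = coroot \<alpha> x" for x
    using v(5) by (metis comp_apply)
  then show ?thesis by (auto simp: fun_eq_iff reflection_def w.diff w.scale)
qed

end

section \<open>Simple reflections and length\<close>

definition word_prod :: "('v \<Rightarrow> 'v) list \<Rightarrow> 'v \<Rightarrow> 'v" where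
  "word_prod xs = foldr (\<circ>) xs id"

lemma word_prod_simps [simp]:
  "word_prod [] = id" "word_prod (x # xs) = x \<circ> word_prod xs"
  by (simp_all add: word_prod_def)

lemma word_prod_append [simp]: "word_prod (xs @ ys) = word_prod xs \<circ> word_prod ys"
  by (induction xs) (simp_all add: comp_assoc)

lemma foldr_comp_eq: "foldr (\<circ>) xs id = word_prod xs"
  by (simp add: word_prod_def)

locale based_root_system = root_system scale \<Phi> coroot
  for scale :: "rat \<Rightarrow> 'v::ab_group_add \<Rightarrow> 'v" and \<Phi> coroot +
  fixes \<Delta> :: "'v set"
  assumes base: "root_base scale \<Phi> \<Delta>"
begin

abbreviation S :: "('v \<Rightarrow> 'v) set" where
  "S \<equiv> refl ` \<Delta>"

section \<open>The base as a vector space basis; positive and negative roots\<close>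

lemma base_subset: "\<Delta> \<subseteq> \<Phi>" and independent_base: "independent \<Delta>"
  using base by (auto simp: root_base_def)

lemma base_root: "\<alpha> \<in> \<Delta> \<Longrightarrow> \<alpha> \<in> \<Phi>"
  using base_subset by auto

lemma finite_base: "finite \<Delta>"
  using base_subset finite_roots finite_subset by auto

lemma span_base_UNIV: "span \<Delta> = UNIV"
proof -
  have "\<Phi> \<subseteq> span \<Delta>"
  proof
    fix \<beta> assume "\<beta> \<in> \<Phi>"
    then obtain c :: "'v \<Rightarrow> nat" where "\<beta> = (\<Sum>\<alpha>\<in>\<Delta>. scale (of_nat (c \<alpha>)) \<alpha>) \<or>
      \<beta> = - (\<Sum>\<alpha>\<in>\<Delta>. scale (of_nat (c \<alpha>)) \<alpha>)"
      using base unfolding root_base_def by blast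
    moreover have "(\<Sum>\<alpha>\<in>\<Delta>. scale (of_nat (c \<alpha>)) \<alpha>) \<in> span \<Delta>"
      by (intro span_sum span_scale span_base)
    ultimately show "\<beta> \<in> span \<Delta>" using span_neg by auto
  qed
  then have "span \<Phi> \<subseteq> span \<Delta>" by (rule span_minimal) (rule subspace_span)
  then show ?thesis using span_roots by auto
qed

abbreviation coeff :: "'v \<Rightarrow> 'v \<Rightarrow> rat" where
  "coeff \<equiv> representation \<Delta>"

lemma coeff_simps:
  "coeff (u + v) \<gamma> = coeff u \<gamma> + coeff v \<gamma>"
  "coeff (u - v) \<gamma> = coeff u \<gamma> - coeff v \<gamma>"
  "coeff (- v) \<gamma> = - coeff v \<gamma>"
  "coeff (scale c v) \<gamma> = c * coeff v \<gamma>"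
  "coeff 0 \<gamma> = 0"
  "coeff (sum g A) \<gamma> = (\<Sum>i\<in>A. coeff (g i) \<gamma>)"
  using independent_base span_base_UNIV
  by (simp_all add: representation_add representation_diff representation_neg
      representation_scale representation_zero representation_sum)

lemma coeff_base: "\<alpha> \<in> \<Delta> \<Longrightarrow> coeff \<alpha> \<gamma> = (if \<gamma> = \<alpha> then 1 else 0)"
  using representation_basis[OF independent_base] by simp

lemma sum_coeff: "(\<Sum>\<alpha>\<in>\<Delta>. scale (coeff v \<alpha>) \<alpha>) = v"
  by (rule sum_representation_eq) (use independent_base span_base_UNIV finite_base in auto)

lemma coeff_nonzero: "v \<noteq> 0 \<Longrightarrow> \<exists>\<gamma>\<in>\<Delta>. coeff v \<gamma> \<noteq> 0"
  using sum_coeff[of v] by (metis (mono_tags, lifting) scale_zero_left sum.neutral)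

definition positive :: "'v \<Rightarrow> bool" where
  "positive \<beta> \<longleftrightarrow> \<beta> \<in> \<Phi> \<and> (\<forall>\<gamma>\<in>\<Delta>. 0 \<le> coeff \<beta> \<gamma>)"

lemma root_signs:
  assumes "\<beta> \<in> \<Phi>"
  shows "(\<forall>\<gamma>\<in>\<Delta>. 0 \<le> coeff \<beta> \<gamma>) \<or> (\<forall>\<gamma>\<in>\<Delta>. coeff \<beta> \<gamma> \<le> 0)"
proof -
  obtain c :: "'v \<Rightarrow> nat" where c: "\<beta> = (\<Sum>\<alpha>\<in>\<Delta>. scale (of_nat (c \<alpha>)) \<alpha>) \<or>
      \<beta> = - (\<Sum>\<alpha>\<in>\<Delta>. scale (of_nat (c \<alpha>)) \<alpha>)"
    using base assms unfolding root_base_def by blast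
  have "coeff (\<Sum>\<alpha>\<in>\<Delta>. scale (of_nat (c \<alpha>)) \<alpha>) \<gamma> \<ge> 0" for \<gamma>
    by (auto simp: coeff_simps coeff_base intro!: sum_nonneg)
  then show ?thesis using c by (auto simp: coeff_simps)
qed

text \<open>A root is nonzero, so some coefficient is nonzero, and by \<open>root_signs\<close> its
  sign is that of all the others.\<close>

lemma positive_uminus:
  assumes "\<beta> \<in> \<Phi>"
  shows "positive (- \<beta>) \<longleftrightarrow> \<not> positive \<beta>"
proof -
  obtain \<gamma> where "\<gamma> \<in> \<Delta>" "coeff \<beta> \<gamma> \<noteq> 0" using coeff_nonzero assms zero_not_root by metis
  then show ?thesis using root_signs[OF assms] uminus_root[OF assms] assms
    by (force simp: positive_def coeff_simps)
qed

lemma positive_base: "\<alpha> \<in> \<Delta> \<Longrightarrow> positive \<alpha>"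
  by (auto simp: positive_def base_root coeff_base)

text \<open>\<open>refl \<alpha>\<close> alters only the coefficient at \<alpha>. If \<beta> turns
  negative, all its other coefficients must vanish, and since the root system is reduced, only
  \<alpha> itself is left.\<close>

lemma refl_simple_positive:
  assumes \<alpha>: "\<alpha> \<in> \<Delta>" and \<beta>: "positive \<beta>" and neg: "\<not> positive (refl \<alpha> \<beta>)"
  shows "\<beta> = \<alpha>"
proof -
  have \<beta>\<Phi>: "\<beta> \<in> \<Phi>" using \<beta> by (simp add: positive_def)
  have r: "refl \<alpha> \<beta> \<in> \<Phi>" by (rule refl_root[OF base_root[OF \<alpha>] \<beta>\<Phi>])
  have "coeff \<beta> \<gamma> = 0" if \<gamma>: "\<gamma> \<in> \<Delta>" "\<gamma> \<noteq> \<alpha>" for \<gamma>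
  proof -
    have "coeff (refl \<alpha> \<beta>) \<gamma> = coeff \<beta> \<gamma>"
      using \<gamma> by (simp add: reflection_def coeff_simps coeff_base[OF \<alpha>])
    moreover have "coeff (refl \<alpha> \<beta>) \<gamma> \<le> 0"
      using root_signs[OF r] neg r \<gamma> by (auto simp: positive_def)
    ultimately show ?thesis using \<beta> \<gamma> by (auto simp: positive_def intro: antisym)
  qed
  then have "(\<Sum>\<gamma>\<in>\<Delta>. scale (coeff \<beta> \<gamma>) \<gamma>) = (\<Sum>\<gamma>\<in>{\<alpha>}. scale (coeff \<beta> \<gamma>) \<gamma>)"
    using \<alpha> finite_base by (intro sum.mono_neutral_right) auto
  then have eq: "\<beta> = scale (coeff \<beta> \<alpha>) \<alpha>" by (simp add: sum_coeff)
  then have "coeff \<beta> \<alpha> = 1 \<or> coeff \<beta> \<alpha> = -1"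
    using reduced[OF base_root[OF \<alpha>], of "coeff \<beta> \<alpha>"] \<beta>\<Phi> by simp
  moreover have "coeff \<beta> \<alpha> \<ge> 0" using \<beta> \<alpha> by (auto simp: positive_def)
  ultimately show ?thesis using eq by auto
qed

section \<open>Words in the simple reflections and the exchange condition\<close>

lemma word_in_W: "set xs \<subseteq> S \<Longrightarrow> word_prod xs \<in> carrier W"
proof (induction xs)
  case Nil
  then show ?case using group.is_monoid[OF group_W, THEN monoid.one_closed]
    by (simp only: word_prod_simps weyl_group_simps(3))
next
  case (Cons x xs)
  then have "x \<in> carrier W" "word_prod xs \<in> carrier W" using refl_in_W base_root by auto
  then show ?case using W_comp by (metis word_prod_simps(2))
qed

text \<open>When the word is applied from the right, the image of \<alpha> turns negative at some
  letter. By \<open>refl_simple_positive\<close> it was the simple root of that letter just before,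
  so \<open>conj_refl\<close> turns \<open>refl \<alpha>\<close> into a second copy of the letter,
  and the two cancel.\<close>

lemma exchange:
  assumes "set xs \<subseteq> S" "\<alpha> \<in> \<Delta>" "\<not> positive (word_prod xs \<alpha>)"
  shows "\<exists>ys. set ys \<subseteq> S \<and> length ys < length xs \<and> word_prod ys = word_prod xs \<circ> refl \<alpha>"
  using assms
proof (induction xs)
  case Nil
  then show ?case using positive_base by simp
next
  case (Cons x xs)
  then obtain \<beta> where \<beta>: "\<beta> \<in> \<Delta>" "x = refl \<beta>" by auto
  note xs = word_in_W[of xs]
  show ?case
  proof (cases "positive (word_prod xs \<alpha>)")
    case True
    have "word_prod xs \<alpha> = \<beta>"
      using refl_simple_positive[OF \<beta>(1) True] Cons.prems \<beta> by simp
    then have "word_prod xs \<circ> refl \<alpha> = refl \<beta> \<circ> word_prod xs"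
      using conj_refl[OF xs base_root[OF Cons.prems(2)]] Cons.prems by simp
    then have "word_prod (x # xs) \<circ> refl \<alpha> = (refl \<beta> \<circ> refl \<beta>) \<circ> word_prod xs"
      using \<beta> by (simp add: comp_assoc)
    also have "\<dots> = word_prod xs" using \<beta> base_root by simp
    finally show ?thesis using Cons.prems(1)
      by (metis insert_subset length_Cons lessI list.simps(15))
  next
    case False
    moreover have "set xs \<subseteq> S" "x \<in> S" using Cons.prems(1) by simp_all
    ultimately obtain ys where ys: "set ys \<subseteq> S" "length ys < length xs"
      "word_prod ys = word_prod xs \<circ> refl \<alpha>"
      using Cons.IH Cons.prems(2) by blast
    then have "word_prod (x # ys) = word_prod (x # xs) \<circ> refl \<alpha>" by (simp add: comp_assoc)
    moreover have "set (x # ys) \<subseteq> S" "length (x # ys) < length (x # xs)"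
      using ys \<open>x \<in> S\<close> by simp_all
    ultimately show ?thesis by blast
  qed
qed

text \<open>The word is cut off just before a letter that makes the image of \<beta> negative; there
  the image is the simple root of that letter.\<close>

lemma word_to_simple_root:
  assumes "set xs \<subseteq> S" "positive \<beta>" "\<not> positive (word_prod xs \<beta>)"
  shows "\<exists>ys. set ys \<subseteq> S \<and> word_prod ys \<beta> \<in> \<Delta>"
  using assms
proof (induction xs)
  case (Cons x xs)
  then obtain \<alpha> where \<alpha>: "\<alpha> \<in> \<Delta>" "x = refl \<alpha>" by auto
  show ?case
  proof (cases "positive (word_prod xs \<beta>)")
    case True
    then have "word_prod xs \<beta> = \<alpha>"
      using refl_simple_positive[OF \<alpha>(1) True] Cons.prems \<alpha> by simp
    then show ?thesis using \<alpha> Cons.prems by auto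
  qed (use Cons in auto)
qed simp

section \<open>Generation of the Weyl group by the simple reflections\<close>

definition words :: "('v \<Rightarrow> 'v) set" where
  "words = {word_prod xs | xs. set xs \<subseteq> S}"

lemma words_comp: "x \<in> words \<Longrightarrow> y \<in> words \<Longrightarrow> x \<circ> y \<in> words"
  unfolding words_def by (clarify, metis Un_least set_append word_prod_append)

lemma words_simple: "\<alpha> \<in> \<Delta> \<Longrightarrow> refl \<alpha> \<in> words"
  unfolding words_def by (auto intro!: exI[of _ "[refl \<alpha>]"])

lemma word_prod_rev:
  "set xs \<subseteq> S \<Longrightarrow> word_prod (rev xs) \<circ> word_prod xs = id"
proof (induction xs)
  case (Cons x xs)
  then have "x \<circ> x = id" using base_root by auto
  then have "word_prod (rev (x # xs)) \<circ> word_prod (x # xs) = word_prod (rev xs) \<circ> word_prod xs"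
    by (simp add: comp_assoc) (metis comp_assoc id_comp)
  then show ?case using Cons by (metis list.set_intros(2) subset_iff)
qed simp

text \<open>The sum of the group elements spanned by the simple reflections kills every simple root,
  hence everything; so the orbit of a positive root cannot consist of positive roots.\<close>

lemma ex_word_negative:
  assumes \<beta>: "positive \<beta>"
  shows "\<exists>g\<in>words. \<not> positive (g \<beta>)"
proof (rule ccontr)
  assume "\<not> ?thesis"
  then have pos: "positive (g \<beta>)" if "g \<in> words" for g using that by auto
  have words_W: "g \<in> carrier W" if "g \<in> words" for g using that word_in_W by (auto simp: words_def)
  have fin: "finite words" by (rule finite_subset[OF _ finite_W]) (use words_W in blast)
  define T where "T v = (\<Sum>g\<in>words. g v)" for v
  have T: "Vector_Spaces.linear scale scale T"
  proof -
    interpret vector_space_pair scale scale ..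
    show ?thesis
      unfolding T_def
      by (rule linear_compose_sum) (use words_W W_linear in blast)
  qed
  have T_simple: "T \<alpha> = 0" if \<alpha>: "\<alpha> \<in> \<Delta>" for \<alpha>
  proof -
    \<comment> \<open>Right multiplication by \<open>refl \<alpha>\<close> permutes
      \<open>words\<close>, so \<open>T\<close> has the same value at \<alpha> and at its
      negative.\<close>
    have "T (refl \<alpha> \<alpha>) = (\<Sum>g\<in>words. (g \<circ> refl \<alpha>) \<alpha>)" by (simp add: T_def)
    also have "\<dots> = (\<Sum>g\<in>words. g \<alpha>)"
    proof (rule sum.reindex_bij_witness[of _ "\<lambda>g. g \<circ> refl \<alpha>" "\<lambda>g. g \<circ> refl \<alpha>"])
      fix g assume "g \<in> words"
      then show "g \<circ> refl \<alpha> \<in> words" "g \<circ> refl \<alpha> \<in> words"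
        using words_comp words_simple[OF \<alpha>] by auto
    qed (use base_root[OF \<alpha>] in \<open>auto simp: comp_assoc\<close>)
    finally have "T (- \<alpha>) = T \<alpha>" using base_root[OF \<alpha>] by (simp add: T_def)
    moreover have "T (- \<alpha>) = - T \<alpha>"
    proof -
      interpret T: Vector_Spaces.linear scale scale T by (rule T)
      show ?thesis by (rule T.neg)
    qed
    ultimately have "scale 2 (T \<alpha>) = 0" by (metis add.right_inverse scale_two)
    then show ?thesis by simp
  qed
  interpret vector_space_pair scale scale ..
  have "Vector_Spaces.linear scale scale (\<lambda>v. 0)" by (rule linear_zero)
  then have "T \<beta> = 0"
    by (rule linear_eq_on[OF T]) (use span_base_UNIV T_simple in auto)
  have id: "id \<in> words" unfolding words_def by (auto intro!: exI[of _ "[]"])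
  \<comment> \<open>Under the assumption that all images of \<beta> are positive,
    \<open>T \<beta> = 0\<close> is a vanishing sum of nonnegative coefficients. Each of them is
    zero, and the one for \<open>id\<close> is that of \<beta>.\<close>
  have "coeff \<beta> \<gamma> = 0" if "\<gamma> \<in> \<Delta>" for \<gamma>
  proof -
    have "(\<Sum>g\<in>words. coeff (g \<beta>) \<gamma>) = 0"
      using \<open>T \<beta> = 0\<close> by (simp add: T_def coeff_simps flip: coeff_simps(6))
    then have "\<forall>g\<in>words. coeff (g \<beta>) \<gamma> = 0"
      by (subst (asm) sum_nonneg_eq_0_iff) (use fin pos that in \<open>auto simp: positive_def\<close>)
    then show ?thesis using id by force
  qed
  then show False using coeff_nonzero[of \<beta>] \<beta> zero_not_root by (auto simp: positive_def)
qed

text \<open>This is \<open>conj_refl\<close> with \<open>w = refl \<alpha>\<close>, which sends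
  \<alpha> to its negative, after cancelling.\<close>

lemma refl_uminus: "\<alpha> \<in> \<Phi> \<Longrightarrow> refl (- \<alpha>) = refl \<alpha>"
proof -
  assume \<alpha>: "\<alpha> \<in> \<Phi>"
  have "(refl \<alpha> \<circ> refl \<alpha>) \<circ> refl \<alpha> = (refl (- \<alpha>) \<circ> refl \<alpha>) \<circ> refl \<alpha>"
    using conj_refl[OF refl_in_W[OF \<alpha>] \<alpha>] \<alpha> by simp
  then show ?thesis using \<alpha> by (simp only: comp_assoc refl_comp_refl) simp
qed

text \<open>Some word \<open>g\<close> takes a positive \<beta> to a simple root, and conjugating
  the reflection in \<open>g \<beta>\<close> back by the reversed word gives
  \<open>refl \<beta>\<close>. A negative root has the same reflection as its opposite.\<close>

lemma refl_in_words:
  assumes "\<beta> \<in> \<Phi>"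
  shows "refl \<beta> \<in> words"
proof -
  have *: "refl \<beta> \<in> words" if \<beta>: "positive \<beta>" for \<beta>
  proof -
    have \<beta>\<Phi>: "\<beta> \<in> \<Phi>" using \<beta> by (simp add: positive_def)
    obtain xs where xs: "set xs \<subseteq> S" "word_prod xs \<beta> \<in> \<Delta>"
      using ex_word_negative[OF \<beta>] word_to_simple_root[OF _ \<beta>] unfolding words_def by blast
    let ?g = "word_prod xs"
    have "word_prod (rev xs) \<circ> (refl (?g \<beta>) \<circ> ?g) = word_prod (rev xs) \<circ> (?g \<circ> refl \<beta>)"
      using conj_refl[OF word_in_W[OF xs(1)] \<beta>\<Phi>] by simp
    also have "\<dots> = refl \<beta>" using word_prod_rev[OF xs(1)] by (metis comp_assoc id_comp)
    finally show ?thesis using words_comp words_simple[OF xs(2)] xs(1)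
      unfolding words_def by (metis (mono_tags, lifting) mem_Collect_eq set_rev)
  qed
  show ?thesis
    using *[of \<beta>] *[of "- \<beta>"] positive_uminus[OF assms] refl_uminus[OF assms] by auto
qed

lemma W_eq_words:
  assumes "w \<in> carrier W"
  shows "\<exists>xs. set xs \<subseteq> S \<and> w = word_prod xs"
proof -
  have "w \<in> generate (GL scale) (refl ` \<Phi>)" using assms by simp
  then have "w \<in> words"
  proof (induction rule: generate.induct)
    case one
    then show ?case by (auto simp: words_def intro!: exI[of _ "[]"])
  next
    case (inv h)
    then obtain \<alpha> where \<alpha>: "\<alpha> \<in> \<Phi>" "h = refl \<alpha>" by auto
    have "inv\<^bsub>GL scale\<^esub> h = h"
      using \<alpha> refl_in_GL by (intro group.inv_equality[OF group_GL[OF vector_space_axioms]]) auto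
    then show ?case using \<alpha> refl_in_words by simp
  next
    case (eng h1 h2)
    then show ?case using words_comp[of h1 h2] by (metis GL_simps(2))
  qed (auto intro: refl_in_words)
  then show ?thesis by (auto simp: words_def)
qed

section \<open>Length, Bruhat order and (-1)-eigenspaces\<close>

lemma word_length_less:
  assumes w: "w \<in> carrier W" and \<alpha>: "\<alpha> \<in> \<Delta>" and neg: "\<not> positive (w \<alpha>)"
  shows "word_length W S (w \<circ> refl \<alpha>) < word_length W S w"
proof -
  have len: "word_length W S u = (LEAST n. \<exists>xs. length xs = n \<and> set xs \<subseteq> S \<and> word_prod xs = u)" for u
    by (simp add: word_length_def foldr_comp_eq)
  have "\<exists>n xs. length xs = n \<and> set xs \<subseteq> S \<and> word_prod xs = w"
    using W_eq_words[OF w] by auto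
  then obtain xs where xs: "length xs = word_length W S w" "set xs \<subseteq> S" "word_prod xs = w"
    unfolding len using LeastI_ex[where P = "\<lambda>n. \<exists>xs. length xs = n \<and> set xs \<subseteq> S \<and> word_prod xs = w"]
    by blast
  \<comment> \<open>\<open>xs\<close> is a shortest word for \<open>w\<close>, so the word from the
    exchange condition gives the strict bound.\<close>
  obtain ys where ys: "set ys \<subseteq> S" "length ys < length xs" "word_prod ys = word_prod xs \<circ> refl \<alpha>"
    using exchange[OF xs(2) \<alpha>] neg xs(3) by blast
  have "word_length W S (w \<circ> refl \<alpha>) \<le> length ys"
    unfolding len by (rule Least_le) (use xs ys in auto)
  then show ?thesis using xs ys by simp
qed


text \<open>\<open>u \<circ> refl \<alpha>\<close> sends \<alpha> to the negative root opposite to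
  \<open>u \<alpha>\<close>, so multiplying it by \<open>refl \<alpha>\<close> again shortens it, to
  \<open>u\<close>. The relation is then a single step, with the identity as conjugating
  element.\<close>

lemma bruhat_less_comp_refl:
  assumes u: "u \<in> carrier W" and \<alpha>: "\<alpha> \<in> \<Delta>" and pos: "positive (u \<alpha>)"
  shows "bruhat_less W S u (u \<circ> refl \<alpha>)"
proof -
  interpret u: Vector_Spaces.linear scale scale u by (rule W_linear[OF u])
  note \<alpha>\<Phi> = base_root[OF \<alpha>]
  have u\<alpha>: "u \<alpha> \<in> \<Phi>" by (rule W_root[OF u \<alpha>\<Phi>])
  have "word_length W S ((u \<circ> refl \<alpha>) \<circ> refl \<alpha>) < word_length W S (u \<circ> refl \<alpha>)"
    by (rule word_length_less[OF W_comp[OF u refl_in_W[OF \<alpha>\<Phi>]] \<alpha>])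
       (use \<alpha>\<Phi> pos positive_uminus[OF u\<alpha>] in \<open>auto simp: u.neg\<close>)
  then have len: "word_length W S u < word_length W S (u \<circ> refl \<alpha>)"
    using \<alpha>\<Phi> by (simp add: comp_assoc)
  have one: "id \<in> carrier W" using group.is_monoid[OF group_W, THEN monoid.one_closed] by simp
  have conj: "conjugate W id (refl \<alpha>) = refl \<alpha>"
    using monoid.inv_one[OF group.is_monoid[OF group_W]] by (simp add: conjugate_def)
  show ?thesis
    unfolding bruhat_less_def
    by (rule r_into_trancl, rule CollectI, rule exI[of _ u], rule exI[of _ id], rule exI[of _ "refl \<alpha>"])
       (use u \<alpha> len one in \<open>simp add: conj\<close>)
qed

text \<open>\<open>x\<close> maps the (-1)-eigenspace of \<open>w\<close> isomorphically onto that
  of \<open>w'\<close>.\<close>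

lemma neg_eigendim_conj:
  assumes x: "x \<in> carrier W" and comm: "x \<circ> w = w' \<circ> x"
  shows "neg_eigendim scale w' = neg_eigendim scale w"
proof -
  interpret finite_dimensional_vector_space_pair_1 scale \<Delta> scale
    using independent_base span_base_UNIV finite_base
    by unfold_locales (auto simp: vector_space_axioms)
  interpret x: Vector_Spaces.linear scale scale x by (rule W_linear[OF x])
  have bij: "bij x" by (rule W_bij[OF x])
  have wx: "w' (x v) = x (w v)" for v using comm by (metis comp_apply)
  have "{v. w' v = - v} = x ` {v. w v = - v}"
  proof (intro antisym subsetI)
    fix v assume v: "v \<in> {v. w' v = - v}"
    obtain u where u: "v = x u" using bij by (meson bij_pointE)
    then have "x (w u) = x (- u)" using v wx by (simp add: x.neg)
    then show "v \<in> x ` {v. w v = - v}" using u bij by (auto simp: bij_def inj_eq)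
  qed (auto simp: wx x.neg)
  then show ?thesis
    unfolding neg_eigendim_def
    using dim_image_eq[OF W_linear[OF x], of "{v. w v = - v}"] inj_on_subset[OF bij_is_inj[OF bij]]
    by simp
qed

lemma commuting_simple_refl:
  assumes w: "w \<in> carrier W" and \<alpha>: "\<alpha> \<in> \<Delta>" and comm: "refl \<alpha> \<circ> w = w \<circ> refl \<alpha>"
  shows "bruhat_less W S w (refl \<alpha> \<circ> w) \<and> neg_eigendim scale w < neg_eigendim scale (refl \<alpha> \<circ> w)
    \<or> bruhat_less W S (refl \<alpha> \<circ> w) w"
proof -
  interpret w: Vector_Spaces.linear scale scale w by (rule W_linear[OF w])
  note \<alpha>\<Phi> = base_root[OF \<alpha>]
  have comm': "refl \<alpha> (w v) = w (refl \<alpha> v)" for v using comm by (metis comp_apply)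
  \<comment> \<open>Evaluating the commutation at \<alpha> puts \<open>w \<alpha>\<close> on the
    line through \<alpha>; the only roots there are \<alpha> and its negative.\<close>
  have "scale 2 (w \<alpha>) = scale (coroot \<alpha> (w \<alpha>)) \<alpha>"
    using comm'[of \<alpha>] \<alpha>\<Phi> by (simp add: w.neg reflection_def[of _ _ \<alpha> "w \<alpha>"] scale_two algebra_simps)
  then have "scale (1/2) (scale 2 (w \<alpha>)) = scale (1/2) (scale (coroot \<alpha> (w \<alpha>)) \<alpha>)" by simp
  then have w\<alpha>: "w \<alpha> = scale (1/2 * coroot \<alpha> (w \<alpha>)) \<alpha>" by simp
  then have "scale (1/2 * coroot \<alpha> (w \<alpha>)) \<alpha> \<in> \<Phi>" using W_root[OF w \<alpha>\<Phi>] by simp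
  then have "1/2 * coroot \<alpha> (w \<alpha>) = 1 \<or> 1/2 * coroot \<alpha> (w \<alpha>) = -1"
    by (rule reduced[OF \<alpha>\<Phi>])
  then have "w \<alpha> = \<alpha> \<or> w \<alpha> = - \<alpha>" using w\<alpha> by (metis scale_minus_left scale_one)
  then show ?thesis
  proof
    assume fixed: "w \<alpha> = \<alpha>"
    let ?E = "\<lambda>w. {v. w v = - v}"
    have sub: "subspace (?E u)" if "Vector_Spaces.linear scale scale u" for u
    proof -
      interpret u: Vector_Spaces.linear scale scale u by fact
      show ?thesis by (auto simp: subspace_def u.add u.scale)
    qed
    \<comment> \<open>As \<open>w\<close> fixes \<alpha>, the commutation makes
      \<open>coroot \<alpha>\<close> invariant under \<open>w\<close>. It therefore vanishes on the
      (-1)-eigenspace of \<open>w\<close>, which \<open>refl \<alpha>\<close> fixes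
      pointwise.\<close>
    have "w v = - v \<Longrightarrow> refl \<alpha> (w v) = - v" for v
    proof -
      assume v: "w v = - v"
      have "scale (coroot \<alpha> (w v)) \<alpha> = scale (coroot \<alpha> v) \<alpha>"
        using comm'[of v] fixed by (simp add: reflection_def w.diff w.scale)
      then have "coroot \<alpha> (w v) = coroot \<alpha> v" using \<alpha>\<Phi> zero_not_root by auto
      then have "coroot \<alpha> v = 0" using v \<alpha>\<Phi> by (simp add: coroot_simps)
      then show ?thesis using v \<alpha>\<Phi> by (simp add: reflection_def coroot_simps)
    qed
    moreover have "\<alpha> \<in> ?E (refl \<alpha> \<circ> w)" using fixed \<alpha>\<Phi> by simp
    moreover have "\<alpha> \<notin> ?E w"
    proof
      assume "\<alpha> \<in> ?E w"
      then have "\<alpha> = - \<alpha>" using fixed by simp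
      then show False using positive_base[OF \<alpha>] positive_uminus[OF \<alpha>\<Phi>] by simp
    qed
    ultimately have less: "?E w \<subset> ?E (refl \<alpha> \<circ> w)" by auto
    interpret finite_dimensional_vector_space scale \<Delta>
      using independent_base span_base_UNIV finite_base by unfold_locales auto
    have "span (?E w) = ?E w" and "span (?E (refl \<alpha> \<circ> w)) = ?E (refl \<alpha> \<circ> w)"
      using sub W_linear[OF w] W_linear[OF W_comp[OF refl_in_W[OF \<alpha>\<Phi>] w]] by (metis span_eq_iff)+
    then have "neg_eigendim scale w < neg_eigendim scale (refl \<alpha> \<circ> w)"
      unfolding neg_eigendim_def by (metis less dim_psubset)
    moreover have "bruhat_less W S w (w \<circ> refl \<alpha>)"
      by (rule bruhat_less_comp_refl[OF w \<alpha>]) (simp add: fixed positive_base \<alpha>)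
    ultimately show ?thesis by (simp add: comm)
  next
    assume neg: "w \<alpha> = - \<alpha>"
    \<comment> \<open>Here \<open>refl \<alpha> \<circ> w\<close> fixes \<alpha>, so the upward step
      starts from it and ends at \<open>w\<close>.\<close>
    have "bruhat_less W S (refl \<alpha> \<circ> w) ((refl \<alpha> \<circ> w) \<circ> refl \<alpha>)"
      by (rule bruhat_less_comp_refl[OF W_comp[OF refl_in_W[OF \<alpha>\<Phi>] w] \<alpha>])
         (simp add: comm neg \<alpha>\<Phi> positive_base \<alpha> w.neg)
    then show ?thesis by (simp add: comm comp_assoc \<alpha>\<Phi>)
  qed
qed

end

section \<open>The signs on the graded module\<close>

text \<open>The interface between Weyl groups and the module: \<open>h\<close> will be
  \<open>neg_eigendim\<close>, and \<open>commuting\<close> is supplied by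
  \<open>commuting_simple_refl\<close>. Everything about signs and induced modules is derived from
  these properties.\<close>

locale graded_involution_module =
  involution_module scale W S a \<rho> + group W
  for scale :: "rat \<Rightarrow> 'm::ab_group_add \<Rightarrow> 'm" and W :: "('g, 'z) monoid_scheme" (structure)
    and S a \<rho> +
  fixes h :: "'g \<Rightarrow> nat"
  assumes finite_carrier: "finite (carrier W)"
    and S_closed: "s \<in> S \<Longrightarrow> s \<in> carrier W"
    and S_square: "s \<in> S \<Longrightarrow> s \<otimes> s = \<one>"
    and S_generates: "x \<in> carrier W \<Longrightarrow> \<exists>xs. set xs \<subseteq> S \<and> x = foldr (\<otimes>) xs \<one>"
    and h_conjugate: "\<lbrakk>x \<in> carrier W; w \<in> carrier W\<rbrakk> \<Longrightarrow> h (conjugate W x w) = h w"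
    and commuting: "\<lbrakk>s \<in> S; w \<in> carrier W; s \<otimes> w = w \<otimes> s\<rbrakk> \<Longrightarrow>
      bruhat_less W S w (s \<otimes> w) \<and> h w < h (s \<otimes> w) \<or> bruhat_less W S (s \<otimes> w) w"
begin

abbreviation I :: "'g set" where
  "I \<equiv> involutions W"

abbreviation conj :: "'g \<Rightarrow> 'g \<Rightarrow> 'g" where
  "conj \<equiv> conjugate W"

abbreviation M :: "nat \<Rightarrow> 'm set" where
  "M \<equiv> filtration scale W h a"

abbreviation sgn\<^sub>M :: "'g \<Rightarrow> 'g \<Rightarrow> rat" where
  "sgn\<^sub>M \<equiv> epsilon scale W h a \<rho>"

section \<open>Conjugation of involutions and the filtered module\<close>

lemma I_closed: "w \<in> I \<Longrightarrow> w \<in> carrier W"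
  by (simp add: involutions_def)

lemma finite_I: "finite I"
  using finite_carrier by (simp add: involutions_def)

lemma conj_one: "w \<in> carrier W \<Longrightarrow> conj \<one> w = w"
  by (simp add: conjugate_def)

lemma conj_mult:
  "\<lbrakk>x \<in> carrier W; y \<in> carrier W; w \<in> carrier W\<rbrakk> \<Longrightarrow> conj (x \<otimes> y) w = conj x (conj y w)"
  by (simp add: conjugate_def inv_mult_group m_assoc)

lemma conj_inv:
  assumes "x \<in> carrier W" "w \<in> carrier W"
  shows "conj (inv x) (conj x w) = w" "conj x (conj (inv x) w) = w"
  using assms conj_mult[of "inv x" x w] conj_mult[of x "inv x" w] by (simp_all add: conj_one)

lemma conj_in_I:
  assumes x: "x \<in> carrier W" and w: "w \<in> I"
  shows "conj x w \<in> I"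
proof -
  have wC: "w \<in> carrier W" and ww: "w \<otimes> w = \<one>" using w by (simp_all add: involutions_def)
  have "inv x \<otimes> (x \<otimes> v) = v" "w \<otimes> (w \<otimes> v) = v" if "v \<in> carrier W" for v
    using that x wC ww by (simp_all flip: m_assoc)
  then have "conj x w \<otimes> conj x w = \<one>" using x wC by (simp add: conjugate_def m_assoc)
  then show ?thesis using x wC by (simp add: involutions_def conjugate_def)
qed

lemma h_conj: "x \<in> carrier W \<Longrightarrow> w \<in> I \<Longrightarrow> h (conj x w) = h w"
  using h_conjugate I_closed by simp

lemma linear_rho: "x \<in> carrier W \<Longrightarrow> Vector_Spaces.linear scale scale (\<rho> x)"
  using representation_hom by (auto simp: hom_def)

lemma rho_simps:
  assumes "x \<in> carrier W"
  shows "\<rho> x (u + v) = \<rho> x u + \<rho> x v" "\<rho> x (u - v) = \<rho> x u - \<rho> x v" "\<rho> x (- v) = - \<rho> x v"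
    "\<rho> x (scale c v) = scale c (\<rho> x v)" "\<rho> x 0 = 0" "\<rho> x (sum f A) = (\<Sum>i\<in>A. \<rho> x (f i))"
proof -
  interpret l: Vector_Spaces.linear scale scale "\<rho> x" by (rule linear_rho[OF assms])
  show "\<rho> x (u + v) = \<rho> x u + \<rho> x v" "\<rho> x (u - v) = \<rho> x u - \<rho> x v" "\<rho> x (- v) = - \<rho> x v"
    "\<rho> x (scale c v) = scale c (\<rho> x v)" "\<rho> x 0 = 0" "\<rho> x (sum f A) = (\<Sum>i\<in>A. \<rho> x (f i))"
    by (rule l.add l.diff l.neg l.scale l.zero l.sum)+
qed

lemma rho_mult: "x \<in> carrier W \<Longrightarrow> y \<in> carrier W \<Longrightarrow> \<rho> (x \<otimes> y) v = \<rho> x (\<rho> y v)"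
  using representation_hom by (auto simp: hom_def)

lemma rho_one: "\<rho> \<one> v = v"
proof -
  have "\<rho> \<one> = \<one>\<^bsub>GL scale\<^esub>"
    by (rule hom_one[OF representation_hom is_group group_GL[OF vector_space_axioms]])
  then show ?thesis by simp
qed

lemma rho_inv:
  "x \<in> carrier W \<Longrightarrow> \<rho> x (\<rho> (inv x) v) = v"
  by (simp flip: rho_mult add: rho_one)

lemma subspace_M: "subspace (M i)"
  by (simp add: filtration_def)

lemmas M_closed = subspace_add[OF subspace_M] subspace_diff[OF subspace_M]
  subspace_scale[OF subspace_M] subspace_0[OF subspace_M] subspace_neg[OF subspace_M]
  subspace_sum[OF subspace_M]

lemma M_antimono: "i \<le> j \<Longrightarrow> M j \<subseteq> M i"
  unfolding filtration_def by (rule span_mono) auto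

lemma a_in_M: "w \<in> I \<Longrightarrow> i \<le> h w \<Longrightarrow> a w \<in> M i"
  unfolding filtration_def by (rule span_base) auto

lemma M_subset_subspace:
  "subspace V \<Longrightarrow> (\<And>w. w \<in> I \<Longrightarrow> i \<le> h w \<Longrightarrow> a w \<in> V) \<Longrightarrow> M i \<subseteq> V"
  unfolding filtration_def by (rule span_minimal) auto

section \<open>Coefficients and leading terms\<close>

definition coeff :: "'m \<Rightarrow> 'g \<Rightarrow> rat" where
  "coeff v w = representation (a ` I) v (a w)"

lemma coeff_simps:
  "coeff (u + v) w = coeff u w + coeff v w" "coeff (u - v) w = coeff u w - coeff v w"
  "coeff (scale c v) w = c * coeff v w" "coeff 0 w = 0"
  "coeff (sum f A) w = (\<Sum>i\<in>A. coeff (f i) w)"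
  using independent_a span_a
  by (simp_all add: coeff_def representation_add representation_diff representation_scale
      representation_zero representation_sum)

lemma coeff_a: "v \<in> I \<Longrightarrow> w \<in> I \<Longrightarrow> coeff (a v) w = (if v = w then 1 else 0)"
  using inj_a by (auto simp: coeff_def representation_basis[OF independent_a] inj_on_def)

text \<open>The expansion of \<open>v\<close> over the basis vectors spanning \<open>M i\<close> is
  also its expansion over the full basis, and \<open>a w\<close> is not among those vectors.\<close>

lemma coeff_M:
  assumes v: "v \<in> M i" and w: "w \<in> I" and less: "h w < i"
  shows "coeff v w = 0"
proof (rule ccontr)
  let ?B = "a ` {w \<in> I. i \<le> h w}"
  assume "coeff v w \<noteq> 0"
  moreover have "?B \<subseteq> a ` I" by auto
  ultimately have "representation ?B v (a w) \<noteq> 0"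
    using representation_extend[OF independent_a, of v ?B] v by (simp add: coeff_def filtration_def)
  then have "a w \<in> ?B" by (rule representation_ne_zero)
  then show False using inj_a w less by (auto simp: inj_on_def)
qed

text \<open>The graded relation that \<open>x\<close> sends the class of \<open>a w\<close> to
  \<open>e\<close> times the class of its conjugate, expressed by representatives modulo the next
  filtration step instead of by cosets.\<close>

definition leads_to :: "'g \<Rightarrow> 'g \<Rightarrow> rat \<Rightarrow> bool" where
  "leads_to x w e \<longleftrightarrow> e \<in> {1, -1} \<and> \<rho> x (a w) - scale e (a (conj x w)) \<in> M (h w + 1)"

text \<open>Only the ascending commuting case has an error term, twice
  \<open>a (s \<otimes> w)\<close>, and \<open>commuting\<close> places it in a deeper layer. The
  descending case is the source of the sign -1.\<close>

lemma leads_to_simple: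
  assumes s: "s \<in> S" and w: "w \<in> I"
  shows "\<exists>e. leads_to s w e"
proof -
  note sC = S_closed[OF s] and wC = I_closed[OF w]
  have inv: "inv s = s" by (rule inv_equality[OF S_square[OF s] sC sC])
  show ?thesis
  proof (cases "s \<otimes> w = w \<otimes> s")
    case True
    then have conj: "conj s w = w"
      using sC wC S_square[OF s] by (simp add: conjugate_def inv m_assoc)
    from commuting[OF s wC True] show ?thesis
    proof
      assume up: "bruhat_less W S w (s \<otimes> w) \<and> h w < h (s \<otimes> w)"
      have "(s \<otimes> w) \<otimes> (w \<otimes> s) = s \<otimes> (w \<otimes> w) \<otimes> s"
        using sC wC by (simp add: m_assoc)
      then have "s \<otimes> w \<in> I"
        using S_square[OF s] w sC True by (simp add: involutions_def)
      then have "scale 2 (a (s \<otimes> w)) \<in> M (h w + 1)" using up by (intro M_closed a_in_M) auto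
      then have "leads_to s w 1" using action_up[OF s w True] up by (simp add: leads_to_def conj)
      then show ?thesis ..
    next
      assume "bruhat_less W S (s \<otimes> w) w"
      then have "leads_to s w (-1)"
        using action_down[OF s w True] by (simp add: leads_to_def conj M_closed)
      then show ?thesis ..
    qed
  next
    case False
    then have "leads_to s w 1"
      using action_conj[OF s w] by (simp add: leads_to_def conjugate_def inv M_closed)
    then show ?thesis ..
  qed
qed

text \<open>Leading terms keep their height because \<open>h\<close> is constant on conjugacy
  classes, and error terms only gain height. The condition on \<open>x\<close> is an assumption
  because the induction over words has it first for the simple reflections alone.\<close>

lemma rho_M_if_leads_to:
  assumes x: "x \<in> carrier W" and leads: "\<And>w. w \<in> I \<Longrightarrow> \<exists>e. leads_to x w e" and v: "v \<in> M i"
  shows "\<rho> x v \<in> M i"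
proof -
  have "M i \<subseteq> {v. \<rho> x v \<in> M i}"
  proof (rule M_subset_subspace)
    show "subspace {v. \<rho> x v \<in> M i}"
      by (simp add: subspace_def rho_simps x M_closed)
    fix w assume w: "w \<in> I" "i \<le> h w"
    obtain e where "\<rho> x (a w) - scale e (a (conj x w)) \<in> M (h w + 1)"
      using leads[OF w(1)] by (auto simp: leads_to_def)
    then have "\<rho> x (a w) - scale e (a (conj x w)) \<in> M i" using M_antimono[of i "h w + 1"] w by auto
    moreover have "scale e (a (conj x w)) \<in> M i"
      using w x by (intro M_closed a_in_M conj_in_I) (simp_all add: h_conj)
    ultimately show "a w \<in> {v. \<rho> x v \<in> M i}"
      using M_closed(1) by (metis diff_add_cancel mem_Collect_eq)
  qed
  then show ?thesis using v by auto
qed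

text \<open>The error term of \<open>y\<close> stays in its layer under \<open>x\<close>, and that
  of \<open>x\<close> lies in the same layer since conjugation by \<open>y\<close> preserves the
  height.\<close>

lemma leads_to_mult:
  assumes x: "x \<in> carrier W" and y: "y \<in> carrier W" and w: "w \<in> I"
    and leads: "\<And>w. w \<in> I \<Longrightarrow> \<exists>e. leads_to x w e"
    and ex: "leads_to x (conj y w) d" and ey: "leads_to y w e"
  shows "leads_to (x \<otimes> y) w (d * e)"
proof -
  note wC = I_closed[OF w]
  let ?m = "\<rho> y (a w) - scale e (a (conj y w))"
  let ?n = "\<rho> x (a (conj y w)) - scale d (a (conj x (conj y w)))"
  have m: "\<rho> x ?m \<in> M (h w + 1)"
    by (rule rho_M_if_leads_to[OF x leads]) (use ey in \<open>simp_all add: leads_to_def\<close>)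
  have n: "?n \<in> M (h w + 1)" using ex by (simp add: leads_to_def h_conj y w)
  have "\<rho> (x \<otimes> y) (a w) - scale (d * e) (a (conj (x \<otimes> y) w)) = \<rho> x ?m + scale e ?n"
    using x y wC by (simp add: rho_mult rho_simps conj_mult scale_right_diff_distrib mult.commute)
  then have "\<rho> (x \<otimes> y) (a w) - scale (d * e) (a (conj (x \<otimes> y) w)) \<in> M (h w + 1)"
    using M_closed(1)[OF m M_closed(3)[OF n]] by simp
  moreover have "d * e \<in> {1, -1}" using ex ey by (auto simp: leads_to_def)
  ultimately show ?thesis by (simp add: leads_to_def)
qed

lemma ex_leads_to:
  assumes x: "x \<in> carrier W" and w: "w \<in> I"
  shows "\<exists>e. leads_to x w e"
proof -
  have "foldr (\<otimes>) xs \<one> \<in> carrier W \<and> (\<forall>w\<in>I. \<exists>e. leads_to (foldr (\<otimes>) xs \<one>) w e)"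
    if "set xs \<subseteq> S" for xs
    using that
  proof (induction xs)
    case Nil
    have "leads_to \<one> w 1" if "w \<in> I" for w
      using that by (simp add: leads_to_def rho_one conj_one I_closed M_closed)
    then show ?case by auto
  next
    case (Cons s xs)
    let ?y = "foldr (\<otimes>) xs \<one>"
    have s: "s \<in> S" using Cons.prems by simp
    have y: "?y \<in> carrier W" and IH: "\<And>w. w \<in> I \<Longrightarrow> \<exists>e. leads_to ?y w e"
      using Cons by auto
    have "\<exists>e. leads_to (s \<otimes> ?y) w e" if w: "w \<in> I" for w
      using leads_to_mult[OF S_closed[OF s] y w leads_to_simple[OF s]] IH[OF w]
        leads_to_simple[OF s conj_in_I[OF y w]] by blast
    then show ?case using S_closed[OF s] y by simp
  qed
  then show ?thesis using S_generates[OF x] w by auto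
qed

lemma rho_M: "x \<in> carrier W \<Longrightarrow> v \<in> M i \<Longrightarrow> \<rho> x v \<in> M i"
  using rho_M_if_leads_to ex_leads_to by blast

text \<open>This links the cosets in \<open>epsilon\<close> with \<open>leads_to\<close>: the
  stability of the filtration under \<open>x\<close> and its inverse gives the equality of cosets,
  and a comparison of coefficients shows that only one sign fits.\<close>

lemma sgn_eqI:
  assumes x: "x \<in> carrier W" and w: "w \<in> I" and e: "leads_to x w e"
  shows "sgn\<^sub>M x w = e"
  unfolding epsilon_def graded_basis_def
proof (rule the_equality)
  let ?N = "M (h w + 1)" and ?w = "conj x w"
  let ?d = "\<rho> x (a w) - scale e (a ?w)"
  have hw: "h ?w = h w" by (rule h_conj[OF x w])
  have d: "?d \<in> ?N" and ee: "e * e = 1" and e1: "e \<in> {1, -1}" using e by (auto simp: leads_to_def)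
  have "\<rho> x ` (+) (a w) ` ?N = scale e ` (+) (a ?w) ` ?N"
  proof (intro antisym subsetI)
    fix v assume "v \<in> \<rho> x ` (+) (a w) ` ?N"
    then obtain u where u: "u \<in> ?N" "v = \<rho> x (a w + u)" by auto
    have "v = scale e (a ?w + scale e (?d + \<rho> x u))"
      using ee by (simp add: u x rho_simps scale_right_distrib)
    moreover have "scale e (?d + \<rho> x u) \<in> ?N" by (intro M_closed d rho_M x u)
    ultimately show "v \<in> scale e ` (+) (a ?w) ` ?N" by blast
  next
    fix v assume "v \<in> scale e ` (+) (a ?w) ` ?N"
    then obtain u where u: "u \<in> ?N" "v = scale e (a ?w + u)" by auto
    \<comment> \<open>The correction is pulled back by the inverse of \<open>x\<close>, which
      preserves the filtration as well.\<close>
    have "v = \<rho> x (a w + \<rho> (inv x) (scale e u - ?d))"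
      using x by (simp add: u rho_simps(1) rho_inv scale_right_distrib)
    moreover have "\<rho> (inv x) (scale e u - ?d) \<in> ?N" using x by (intro M_closed d rho_M u) simp
    ultimately show "v \<in> \<rho> x ` (+) (a w) ` ?N" by blast
  qed
  then show "e \<in> {1, -1} \<and> \<rho> x ` (+) (a w) ` ?N = scale e ` (+) (a ?w) ` M (h ?w + 1)"
    using e1 hw by simp
  fix e' assume e': "e' \<in> {1, -1} \<and> \<rho> x ` (+) (a w) ` ?N = scale e' ` (+) (a ?w) ` M (h ?w + 1)"
  \<comment> \<open>Applied to the representative \<open>a w\<close>, a second sign puts
    \<open>e' - e\<close> times a basis vector of height \<open>h w\<close> into
    \<open>M (h w + 1)\<close>, where its coefficient must vanish.\<close>
  have "\<rho> x (a w + 0) \<in> \<rho> x ` (+) (a w) ` ?N" using M_closed(4) by blast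
  then obtain u where u: "u \<in> ?N" "\<rho> x (a w) = scale e' (a ?w + u)" using e' hw by auto
  then have "scale (e' - e) (a ?w) = ?d - scale e' u"
    by (simp add: scale_right_distrib scale_left_diff_distrib)
  then have "scale (e' - e) (a ?w) \<in> ?N" using M_closed(2)[OF d M_closed(3)[OF u(1)]] by simp
  then have "coeff (scale (e' - e) (a ?w)) ?w = 0"
    using conj_in_I[OF x w] hw by (intro coeff_M) auto
  then show "e' = e" using conj_in_I[OF x w] by (simp add: coeff_simps coeff_a)
qed

lemma leads_to_sgn: "x \<in> carrier W \<Longrightarrow> w \<in> I \<Longrightarrow> leads_to x w (sgn\<^sub>M x w)"
  using ex_leads_to sgn_eqI by blast

lemma sgn_mult:
  "\<lbrakk>x \<in> carrier W; y \<in> carrier W; w \<in> I\<rbrakk> \<Longrightarrow> sgn\<^sub>M (x \<otimes> y) w = sgn\<^sub>M x (conj y w) * sgn\<^sub>M y w"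
  by (intro sgn_eqI leads_to_mult ex_leads_to leads_to_sgn conj_in_I) auto

lemma sgn_square: "x \<in> carrier W \<Longrightarrow> w \<in> I \<Longrightarrow> sgn\<^sub>M x w * sgn\<^sub>M x w = 1"
  using leads_to_sgn[of x w] by (auto simp: leads_to_def)

text \<open>The part of \<open>\<rho> x (a v)\<close> beyond its leading term lies in heights above
  \<open>h v\<close>, so it is invisible at \<open>w\<close>.\<close>

lemma coeff_rho:
  assumes x: "x \<in> carrier W" and v: "v \<in> I" and w: "w \<in> I" and le: "h w \<le> h v"
  shows "coeff (\<rho> x (a v)) w = (if conj x v = w then sgn\<^sub>M x v else 0)"
proof -
  have "coeff (\<rho> x (a v) - scale (sgn\<^sub>M x v) (a (conj x v))) w = 0"
    using leads_to_sgn[OF x v] le w by (intro coeff_M) (auto simp: leads_to_def)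
  then show ?thesis using conj_in_I[OF x v] w by (simp add: coeff_simps coeff_a)
qed

lemma centralizer_iff: "r \<in> carrier W \<Longrightarrow> z \<in> centralizer W r \<longleftrightarrow> z \<in> carrier W \<and> conj z r = r"
  by (auto simp: centralizer_def conjugate_def inv_solve_right')

end

section \<open>The isomorphism with the sum of induced modules\<close>

locale involution_classes = graded_involution_module scale W S a \<rho> h
  for scale :: "rat \<Rightarrow> 'm::ab_group_add \<Rightarrow> 'm" and W :: "('g, 'z) monoid_scheme" (structure)
    and S a \<rho> h +
  fixes R :: "'g set"
  assumes representatives: "class_representatives W (involutions W) R"
begin

section \<open>Representatives of the classes of involutions\<close>

lemma R_subset: "R \<subseteq> I"
  using representatives by (simp add: class_representatives_def)

lemma R_in_I: "r \<in> R \<Longrightarrow> r \<in> I" and R_closed: "r \<in> R \<Longrightarrow> r \<in> carrier W"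
  using R_subset I_closed by auto

lemma finite_R: "finite R"
  using R_subset finite_I finite_subset by auto

lemma ex1_representative:
  assumes "w \<in> I"
  shows "\<exists>!r. r \<in> R \<inter> conj_class W w"
proof -
  have "conj_class W w \<subseteq> I" using assms conj_in_I by (auto simp: conj_class_def)
  then show ?thesis using representatives I_closed[OF assms] by (simp add: class_representatives_def)
qed

lemma ex_representative:
  assumes w: "w \<in> I"
  shows "\<exists>r\<in>R. \<exists>g\<in>carrier W. w = conj g r"
proof -
  obtain r x where "r \<in> R" "x \<in> carrier W" "r = conj x w"
    using ex1_representative[OF w] by (auto simp: conj_class_def)
  then show ?thesis using conj_inv(1)[of x w] I_closed[OF w] by (metis inv_closed)
qed

lemma representative_unique:
  assumes "r \<in> R" "r' \<in> R" "g \<in> carrier W" "g' \<in> carrier W" "conj g r = conj g' r'"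
  shows "r = r'"
proof -
  have "r = conj (inv g) (conj g r)" "r' = conj (inv g') (conj g r)"
    using assms conj_inv(1) R_closed by metis+
  then have "r \<in> conj_class W (conj g r)" "r' \<in> conj_class W (conj g r)"
    using assms unfolding conj_class_def by (metis imageI inv_closed)+
  then show ?thesis using ex1_representative[OF conj_in_I[OF assms(3) R_in_I[OF assms(1)]]] assms
    by blast
qed

section \<open>The direct sum of induced modules and its map to the module\<close>

abbreviation V :: "('g \<Rightarrow> 'g \<Rightarrow> rat) set" where
  "V \<equiv> direct_sum_space R (\<lambda>w. ind_space W (centralizer W w) (\<lambda>x. sgn\<^sub>M x w))"

abbreviation act :: "'g \<Rightarrow> ('g \<Rightarrow> 'g \<Rightarrow> rat) \<Rightarrow> 'g \<Rightarrow> 'g \<Rightarrow> rat" where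
  "act \<equiv> direct_sum_action R (\<lambda>w. ind_action W)"

text \<open>The signs equal their own inverses, and the finiteness of \<open>R\<close> gives the
  finite support.\<close>

lemma V_iff:
  "F \<in> V \<longleftrightarrow> (\<forall>r. r \<notin> R \<longrightarrow> F r = 0) \<and>
    (\<forall>r\<in>R. (\<forall>g. g \<notin> carrier W \<longrightarrow> F r g = 0) \<and>
      (\<forall>g\<in>carrier W. \<forall>z\<in>carrier W. conj z r = r \<longrightarrow> F r (g \<otimes> z) = sgn\<^sub>M z r * F r g))"
proof -
  have "inverse (sgn\<^sub>M z r) = sgn\<^sub>M z r" if "r \<in> R" "z \<in> carrier W" for r z
    using leads_to_sgn[OF that(2) R_in_I[OF that(1)]] by (auto simp: leads_to_def)
  moreover have "finite {r. F r \<noteq> 0}" if "\<forall>r. r \<notin> R \<longrightarrow> F r = 0"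
    using that by (intro finite_subset[OF _ finite_R]) auto
  ultimately show ?thesis
    by (auto simp: direct_sum_space_def ind_space_def centralizer_iff R_closed)
qed

lemma V_add: "F \<in> V \<Longrightarrow> G \<in> V \<Longrightarrow> F + G \<in> V"
  by (auto simp: V_iff algebra_simps)

lemma V_diff: "F \<in> V \<Longrightarrow> G \<in> V \<Longrightarrow> F - G \<in> V"
  by (auto simp: V_iff algebra_simps)

lemma V_scale: "F \<in> V \<Longrightarrow> direct_sum_scale c F \<in> V"
  by (auto simp: V_iff direct_sum_scale_def fun_eq_iff)

lemma V_act:
  assumes F: "F \<in> V" and x: "x \<in> carrier W"
  shows "act x F \<in> V"
  using F x by (auto simp: V_iff direct_sum_action_def ind_action_def m_assoc[symmetric])

text \<open>The centralizer of \<open>r\<close> acts on \<open>a r\<close> by signs only modulo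
  deeper layers, so the summand need not be constant on cosets of the centralizer. Summing over the
  whole group avoids a choice of coset representatives and keeps the map equivariant.\<close>

definition to_module :: "('g \<Rightarrow> 'g \<Rightarrow> rat) \<Rightarrow> 'm" where
  "to_module F = (\<Sum>r\<in>R. \<Sum>g\<in>carrier W. scale (F r g) (\<rho> g (a r)))"

lemma to_module_add: "to_module (F + G) = to_module F + to_module G"
  by (simp add: to_module_def scale_left_distrib sum.distrib)

lemma to_module_diff: "to_module (F - G) = to_module F - to_module G"
  by (simp add: to_module_def scale_left_diff_distrib sum_subtractf)

lemma to_module_scale: "to_module (direct_sum_scale c F) = scale c (to_module F)"
  by (simp add: to_module_def direct_sum_scale_def scale_sum_right)

lemma to_module_act:
  assumes x: "x \<in> carrier W"
  shows "to_module (act x F) = \<rho> x (to_module F)"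
proof -
  have "(\<Sum>g\<in>carrier W. scale (act x F r g) (\<rho> g (a r)))
      = (\<Sum>g\<in>carrier W. scale (F r g) (\<rho> x (\<rho> g (a r))))" if "r \<in> R" for r
    \<comment> \<open>The sum is reindexed by left multiplication with \<open>x\<close>.\<close>
    by (rule sum.reindex_bij_witness[of _ "\<lambda>g. x \<otimes> g" "\<lambda>g. inv x \<otimes> g"])
       (use x that in \<open>auto simp: direct_sum_action_def ind_action_def m_assoc[symmetric] simp flip: rho_mult\<close>)
  then show ?thesis by (simp add: to_module_def rho_simps x)
qed

text \<open>By \<open>low\<close>, only components of height at least \<open>h r\<close> contribute,
  and for these \<open>coeff_rho\<close> sees nothing but leading terms. Components other than
  \<open>r\<close> belong to other conjugacy classes and miss \<open>conj g r\<close>.\<close>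

lemma coeff_to_module:
  assumes F: "F \<in> V" and r: "r \<in> R" and g: "g \<in> carrier W"
    and low: "\<And>r'. r' \<in> R \<Longrightarrow> h r' < h r \<Longrightarrow> F r' = 0"
  shows "coeff (to_module F) (conj g r)
    = of_nat (card {x \<in> carrier W. conj x r = conj g r}) * (F r g * sgn\<^sub>M g r)"
proof -
  let ?w = "conj g r" and ?X = "{x \<in> carrier W. conj x r = conj g r}"
  note rI = R_in_I[OF r] and rC = R_closed[OF r]
  have wI: "?w \<in> I" and hw: "h ?w = h r" using conj_in_I[OF g rI] h_conj[OF g rI] by auto
  have zero: "F r' x * coeff (\<rho> x (a r')) ?w = 0"
    if r': "r' \<in> R" "r' \<noteq> r" and x: "x \<in> carrier W" for r' x
  proof (cases "h r' < h r")
    case False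
    have "conj x r' \<noteq> ?w" using representative_unique[OF r'(1) r x g] r'(2) by auto
    then show ?thesis using coeff_rho[OF x R_in_I[OF r'(1)] wI] False hw by simp
  qed (simp add: low r')
  have const: "F r x * sgn\<^sub>M x r = F r g * sgn\<^sub>M g r" if x: "x \<in> ?X" for x
  proof -
    \<comment> \<open>\<open>x\<close> and \<open>g\<close> conjugate \<open>r\<close> to the same
      element, so they differ by a centralizing \<open>z\<close>. Its sign enters once through the
      equivariance of \<open>F r\<close> and once through \<open>sgn_mult\<close>, and its square is
      1.\<close>
    define z where "z = inv g \<otimes> x"
    have z: "z \<in> carrier W" "x = g \<otimes> z" using x g by (auto simp: z_def simp flip: m_assoc)
    have zr: "conj z r = r" using x g rC conj_inv(1) by (auto simp: z_def conj_mult)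
    have "F r x = sgn\<^sub>M z r * F r g" using F r g z zr by (auto simp: V_iff)
    moreover have "sgn\<^sub>M x r = sgn\<^sub>M g r * sgn\<^sub>M z r" using sgn_mult[OF g z(1) rI] z zr by simp
    ultimately have "F r x * sgn\<^sub>M x r = (sgn\<^sub>M z r * sgn\<^sub>M z r) * (F r g * sgn\<^sub>M g r)" by simp
    then show ?thesis using sgn_square[OF z(1) rI] by simp
  qed
  have "coeff (to_module F) ?w = (\<Sum>r'\<in>R. \<Sum>x\<in>carrier W. F r' x * coeff (\<rho> x (a r')) ?w)"
    by (simp add: to_module_def coeff_simps)
  also have "\<dots> = (\<Sum>r'\<in>{r}. \<Sum>x\<in>carrier W. F r' x * coeff (\<rho> x (a r')) ?w)"
  proof (intro sum.mono_neutral_right ballI finite_R)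
    fix r' assume "r' \<in> R - {r}"
    then show "(\<Sum>x\<in>carrier W. F r' x * coeff (\<rho> x (a r')) ?w) = 0"
      using zero by (intro sum.neutral) auto
  qed (use r in auto)
  also have "\<dots> = (\<Sum>x\<in>carrier W. F r x * coeff (\<rho> x (a r)) ?w)" by simp
  also have "\<dots> = (\<Sum>x\<in>?X. F r x * coeff (\<rho> x (a r)) ?w)"
    by (rule sum.mono_neutral_right) (use finite_carrier coeff_rho[OF _ rI wI] hw in auto)
  also have "\<dots> = (\<Sum>x\<in>?X. F r g * sgn\<^sub>M g r)"
    using coeff_rho[OF _ rI wI] hw const by (intro sum.cong) auto
  finally show ?thesis by simp
qed

lemma card_conj_pos:
  assumes "g \<in> carrier W"
  shows "card {x \<in> carrier W. conj x r = conj g r} > 0"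
  using assms finite_carrier by (subst card_gt_0_iff) auto

lemma to_module_eq_0:
  assumes F: "F \<in> V" and 0: "to_module F = 0"
  shows "F = 0"
proof (rule ccontr)
  assume "F \<noteq> 0"
  then have "\<exists>r. r \<in> R \<and> F r \<noteq> 0" using F by (force simp: V_iff fun_eq_iff)
  \<comment> \<open>A nonvanishing component of least height satisfies the condition
    \<open>low\<close> of \<open>coeff_to_module\<close>.\<close>
  then obtain r where r: "r \<in> R" "F r \<noteq> 0"
    and min: "\<And>r'. r' \<in> R \<and> F r' \<noteq> 0 \<Longrightarrow> h r \<le> h r'"
    using ex_has_least_nat[of "\<lambda>r. r \<in> R \<and> F r \<noteq> 0" _ h] by blast
  obtain g where g: "F r g \<noteq> 0" using r by (auto simp: fun_eq_iff)
  then have gC: "g \<in> carrier W" using F r by (auto simp: V_iff)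
  have "coeff (to_module F) (conj g r)
    = of_nat (card {x \<in> carrier W. conj x r = conj g r}) * (F r g * sgn\<^sub>M g r)"
    using min by (intro coeff_to_module F r gC) force
  moreover have "sgn\<^sub>M g r \<noteq> 0" using sgn_square[OF gC R_in_I[OF r(1)]] by auto
  ultimately show False using 0 g card_conj_pos[OF gC, of r] by (simp add: coeff_simps)
qed

lemma subspace_range: "subspace (to_module ` V)"
  unfolding subspace_def
proof safe
  have "0 \<in> V" by (simp add: V_iff)
  then show "0 \<in> to_module ` V" by (rule image_eqI[rotated]) (simp add: to_module_def)
next
  fix F G assume "F \<in> V" "G \<in> V"
  then show "to_module F + to_module G \<in> to_module ` V"
    unfolding to_module_add[symmetric] by (intro imageI V_add)
next
  fix c F assume "F \<in> V"
  then show "scale c (to_module F) \<in> to_module ` V"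
    unfolding to_module_scale[symmetric] by (intro imageI V_scale)
qed

text \<open>The measure is the distance from the greatest height, so the induction hypothesis covers
  all involutions higher than \<open>w\<close>, hence all of \<open>M (h w + 1)\<close>.\<close>

lemma a_in_range: "w \<in> I \<Longrightarrow> a w \<in> to_module ` V"
proof (induction "Max (h ` I) - h w" arbitrary: w rule: less_induct)
  case less
  have M_sub: "M (h w + 1) \<subseteq> to_module ` V"
  proof (rule M_subset_subspace[OF subspace_range])
    fix v assume v: "v \<in> I" "h w + 1 \<le> h v"
    have "h v \<le> Max (h ` I)" using v finite_I by simp
    then show "a v \<in> to_module ` V" using v by (intro less.hyps) auto
  qed
  obtain r g where r: "r \<in> R" and g: "g \<in> carrier W" and w: "w = conj g r"
    using ex_representative[OF less.prems] by auto
  note rI = R_in_I[OF r] and rC = R_closed[OF r]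
  let ?X = "{x \<in> carrier W. conj x r = w}"
  \<comment> \<open>\<open>F\<close> lives in the component \<open>r\<close>, on the coset of the
    centralizer carrying \<open>r\<close> to \<open>w\<close>. Its values are the signs themselves,
    so each summand of the image has leading term exactly \<open>a w\<close>.\<close>
  define F where "F r' x = (if r' = r \<and> x \<in> ?X then sgn\<^sub>M x r else 0)" for r' x
  have F: "F \<in> V"
    unfolding V_iff
    using sgn_mult[OF _ _ rI] rC by (auto simp: F_def fun_eq_iff r conj_mult)
  have "to_module F = (\<Sum>r'\<in>{r}. \<Sum>x\<in>carrier W. scale (F r' x) (\<rho> x (a r')))"
    unfolding to_module_def using r finite_R by (intro sum.mono_neutral_right) (auto simp: F_def)
  also have "\<dots> = (\<Sum>x\<in>?X. scale (sgn\<^sub>M x r) (\<rho> x (a r)))"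
    using finite_carrier by (simp, intro sum.mono_neutral_cong_right) (auto simp: F_def)
  finally have "to_module F - scale (of_nat (card ?X)) (a w)
    = (\<Sum>x\<in>?X. scale (sgn\<^sub>M x r) (\<rho> x (a r)) - a w)"
    by (simp add: sum_subtractf sum_constant_scale)
  also have "\<dots> \<in> M (h w + 1)"
  proof (rule M_closed(6))
    fix x assume x: "x \<in> ?X"
    have "scale (sgn\<^sub>M x r) (\<rho> x (a r) - scale (sgn\<^sub>M x r) (a w)) \<in> M (h r + 1)"
      using leads_to_sgn[OF _ rI] x by (intro M_closed(3)) (auto simp: leads_to_def)
    then show "scale (sgn\<^sub>M x r) (\<rho> x (a r)) - a w \<in> M (h w + 1)"
      using x sgn_square[OF _ rI] w h_conj[OF g rI] by (simp add: scale_right_diff_distrib)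
  qed
  finally have "to_module F - scale (of_nat (card ?X)) (a w) \<in> to_module ` V" using M_sub by blast
  moreover have "to_module F \<in> to_module ` V" using F by blast
  ultimately have "to_module F - (to_module F - scale (of_nat (card ?X)) (a w)) \<in> to_module ` V"
    using subspace_diff[OF subspace_range] by blast
  then have "scale (of_nat (card ?X)) (a w) \<in> to_module ` V" by simp
  \<comment> \<open>The coset is nonempty, so its cardinality can be inverted over the
    rationals.\<close>
  from subspace_scale[OF subspace_range this, of "inverse (of_nat (card ?X))"]
  show ?case using card_conj_pos[OF g, of r] w by simp
qed

lemma bij_to_module: "bij_betw to_module V UNIV"
proof (rule bij_betw_imageI)
  show "inj_on to_module V"
  proof (rule inj_onI)
    fix F G assume "F \<in> V" "G \<in> V" "to_module F = to_module G"
    then have "F - G = 0" by (intro to_module_eq_0 V_diff) (simp_all add: to_module_diff)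
    then show "F = G" by simp
  qed
  then have "span (a ` I) \<subseteq> to_module ` V" using a_in_range by (intro span_minimal subspace_range) auto
  then show "to_module ` V = UNIV" using span_a by auto
qed

theorem module_isomorphic_induced: "rep_isomorphic W scale UNIV \<rho> direct_sum_scale V act"
  unfolding rep_isomorphic_def
proof (intro exI conjI ballI allI)
  \<comment> \<open>The isomorphism has to start at the module, so it is the inverse of
    \<open>to_module\<close>; its linearity and equivariance follow by injectivity on
    \<open>V\<close>.\<close>
  let ?T = "inv_into V to_module"
  show "bij_betw ?T UNIV V" by (rule bij_betw_inv_into[OF bij_to_module])
  have T: "?T m \<in> V" "to_module (?T m) = m" for m
    using bij_to_module by (simp_all add: bij_betw_def inv_into_into f_inv_into_f)
  have eqI: "?T m = F" if "F \<in> V" "to_module F = m" for m F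
    using that bij_to_module by (auto simp: bij_betw_def)
  show "?T (u + v) = ?T u + ?T v" for u v
    by (rule eqI) (simp_all add: V_add T to_module_add)
  show "?T (scale c v) = direct_sum_scale c (?T v)" for c v
    by (rule eqI) (simp_all add: V_scale T to_module_scale)
  show "?T (\<rho> x v) = act x (?T v)" if "x \<in> carrier W" for x v
    by (rule eqI) (simp_all add: V_act T to_module_act that)
qed

end

theorem mainTheorem4:
  fixes scaleV :: "rat \<Rightarrow> 'v::ab_group_add \<Rightarrow> 'v"
    and \<Phi> \<Delta> :: "'v set"
    and coroot :: "'v \<Rightarrow> 'v \<Rightarrow> rat"
    and W :: "('v \<Rightarrow> 'v) monoid"
    and S R :: "('v \<Rightarrow> 'v) set"
    and scaleM :: "rat \<Rightarrow> 'm::ab_group_add \<Rightarrow> 'm"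
    and a :: "('v \<Rightarrow> 'v) \<Rightarrow> 'm"
    and \<rho> :: "('v \<Rightarrow> 'v) \<Rightarrow> 'm \<Rightarrow> 'm"
    and \<epsilon> :: "('v \<Rightarrow> 'v) \<Rightarrow> ('v \<Rightarrow> 'v) \<Rightarrow> rat"
  assumes "root_system scaleV \<Phi> coroot"
    and "root_base scaleV \<Phi> \<Delta>"
    and "W = weyl_group scaleV \<Phi> coroot"
    and "S = reflection scaleV coroot ` \<Delta>"
    and "involution_module scaleM W S a \<rho>"
    and "\<epsilon> = epsilon scaleM W (neg_eigendim scaleV) a \<rho>"
    and "class_representatives W (involutions W) R"
  shows "rep_isomorphic W scaleM UNIV \<rho> direct_sum_scale
           (direct_sum_space R (\<lambda>w. ind_space W (centralizer W w) (\<lambda>x. \<epsilon> x w)))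
           (direct_sum_action R (\<lambda>w. ind_action W))"
proof -
  interpret rs: based_root_system scaleV \<Phi> coroot \<Delta>
    by (intro based_root_system.intro based_root_system_axioms.intro assms(1,2))
  note W = assms(3)
  have simple: "\<exists>\<alpha>\<in>\<Delta>. s = rs.refl \<alpha>" if "s \<in> S" for s
    using that assms(4) by auto
  interpret involution_classes scaleM W S a \<rho> "neg_eigendim scaleV" R
  proof (intro involution_classes.intro graded_involution_module.intro
      graded_involution_module_axioms.intro involution_classes_axioms.intro assms(5,7))
    show "group W" "finite (carrier W)"
      using rs.group_W rs.finite_W by (simp_all only: W)
    show "s \<in> carrier W" if "s \<in> S" for s
      using simple[OF that] rs.refl_in_W rs.base_root unfolding W by blast
    show "s \<otimes>\<^bsub>W\<^esub> s = \<one>\<^bsub>W\<^esub>" if "s \<in> S" for s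
      using simple[OF that] rs.refl_comp_refl rs.base_root unfolding W weyl_group_simps by blast
    show "\<exists>xs. set xs \<subseteq> S \<and> x = foldr (\<otimes>\<^bsub>W\<^esub>) xs \<one>\<^bsub>W\<^esub>" if "x \<in> carrier W" for x
      using rs.W_eq_words that unfolding W assms(4) weyl_group_simps(2,3) foldr_comp_eq by blast
    show "neg_eigendim scaleV (conjugate W x w) = neg_eigendim scaleV w"
      if "x \<in> carrier W" "w \<in> carrier W" for x w
    proof (rule rs.neg_eigendim_conj)
      show x: "x \<in> carrier rs.W" using that W by simp
      show "x \<circ> w = conjugate W x w \<circ> x"
        unfolding conjugate_def W weyl_group_simps(2) by (simp only: comp_assoc rs.W_inv(3)[OF x]) simp
    qed
    show "bruhat_less W S w (s \<otimes>\<^bsub>W\<^esub> w) \<and> neg_eigendim scaleV w < neg_eigendim scaleV (s \<otimes>\<^bsub>W\<^esub> w)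
      \<or> bruhat_less W S (s \<otimes>\<^bsub>W\<^esub> w) w"
      if "s \<in> S" "w \<in> carrier W" "s \<otimes>\<^bsub>W\<^esub> w = w \<otimes>\<^bsub>W\<^esub> s" for s w
      using simple[OF that(1)] rs.commuting_simple_refl[of w] that(2,3)
      unfolding W assms(4) weyl_group_simps(2) by blast
  qed
  show ?thesis
    using module_isomorphic_induced unfolding assms(6) .
qed

end
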